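(* Let $K=[-\tfrac12,\tfrac12]^m$ and $\Omega=[-\tfrac12+\Delta,\tfrac12-\Delta]^m$ for some $0<\Delta<\tfrac12$, and $\mathfrak f_\Delta:=\Delta^2\mathfrak f$. Then for all $h\in L^2(\Omega)$, $$\big\|\mathcal{D}(h)|_{\mathbb{R}^m\setminus K}\big\|\le\big\|\hat p^{\mathrm{leak}}_{\mathfrak f,\mathfrak f_\Delta}\cdot\mathcal{F}(h)\big\|,\qquad \hat p^{\mathrm{leak}}_{\mathfrak f,\mathfrak f_\Delta}(\boldsymbol\xi):=\Big(\sum_{j=1}^m\big|e_{\mathfrak f_\Delta}(\mathfrak f^{-1/2}\xi_j)\big|^2\Big)^{1/2},$$ where $e_{\mathfrak f_\Delta}(x):=\big(|\tilde\theta(x-\mathfrak f_\Delta^{1/2})|^2+|\tilde\theta(-x-\mathfrak f_\Delta^{1/2})|^2\big)^{1/2}$ for $x\in\mathbb{R}$.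
   Context: Fourier transform $\mathcal{F}(f)(\boldsymbol\xi)=(2\pi)^{-m/2}\int e^{-\mathrm{i}\boldsymbol\xi\cdot\boldsymbol x}f(\boldsymbol x)\,\mathrm{d}\boldsymbol x$ (unitary on $L^2(\mathbb{R}^m)$). Fix $\mathfrak f>0$; $\mathcal{D}(h)=\mathcal{F}^{-1}(m_{\mathfrak f}\mathcal{F}(h))$ with $m_{\mathfrak f}(\boldsymbol\xi)=\exp(-\mathrm{i}|\boldsymbol\xi|^2/(2\mathfrak f))$. Fresnel integrals $\mathrm C(x)=\int_0^x\cos(\tfrac\pi2t^2)\,\mathrm dt$, $\mathrm S(x)=\int_0^x\sin(\tfrac\pi2t^2)\,\mathrm dt$; $\tilde\theta(y)=\tfrac12-\tfrac{1-\mathrm i}{2}\big(\mathrm C(-y/\sqrt\pi)+\mathrm i\,\mathrm S(-y/\sqrt\pi)\big)$. $f|_A:=\mathbf 1_Af$; $L^2(\Omega)$ = functions in $L^2(\mathbb{R}^m)$ supported in $\Omega$. *)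

theory Defs
  imports "HOL-Analysis.Analysis"
begin

text \<open>Fourier integral with sign s (s = -1: forward transform F, s = 1: inverse),
  unitary normalisation (2 pi)^(-m/2). Meaningful for integrable functions.\<close>
definition fourier_integral :: "real \<Rightarrow> (real^'n \<Rightarrow> complex) \<Rightarrow> real^'n \<Rightarrow> complex" where
  "fourier_integral s f \<xi> =
     complex_of_real ((2 * pi) powr (- real CARD('n) / 2)) *
     (LINT x|lborel. cis (s * (\<xi> \<bullet> x)) * f x)"

text \<open>Plancherel extension to L^2: the L^2-limit of the transforms of the truncations
  f restricted to balls of radius R, R \<rightarrow> \<infinity> (determined up to null sets).\<close>
definition fourier_L2 :: "real \<Rightarrow> (real^'n \<Rightarrow> complex) \<Rightarrow> real^'n \<Rightarrow> complex" where
  "fourier_L2 s f = (SOME G. G \<in> borel_measurable lborel \<and>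
      ((\<lambda>R. \<integral>\<^sup>+ \<xi>. ennreal ((cmod (fourier_integral s (\<lambda>x. indicator (ball 0 R) x * f x) \<xi> - G \<xi>))\<^sup>2) \<partial>lborel)
        \<longlongrightarrow> 0) at_top)"

definition FT :: "(real^'n \<Rightarrow> complex) \<Rightarrow> real^'n \<Rightarrow> complex" where
  "FT f = fourier_L2 (-1) f"

definition IFT :: "(real^'n \<Rightarrow> complex) \<Rightarrow> real^'n \<Rightarrow> complex" where
  "IFT f = fourier_L2 1 f"

definition L2_on :: "(real^'n) set \<Rightarrow> (real^'n \<Rightarrow> complex) set" where
  "L2_on A = {h. h \<in> borel_measurable lborel \<and>
                 (\<integral>\<^sup>+ x. ennreal ((cmod (h x))\<^sup>2) \<partial>lborel) < \<infinity> \<and>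
                 (\<forall>x. x \<notin> A \<longrightarrow> h x = 0)}"

definition mult_f :: "real \<Rightarrow> real^'n \<Rightarrow> complex" where
  "mult_f fr \<xi> = cis (- (norm \<xi>)\<^sup>2 / (2 * fr))"

definition propD :: "real \<Rightarrow> (real^'n \<Rightarrow> complex) \<Rightarrow> real^'n \<Rightarrow> complex" where
  "propD fr h = IFT (\<lambda>\<xi>. mult_f fr \<xi> * FT h \<xi>)"

definition fresnelC :: "real \<Rightarrow> real" where
  "fresnelC x = (LBINT t=0..x. cos (pi / 2 * t\<^sup>2))"

definition fresnelS :: "real \<Rightarrow> real" where
  "fresnelS x = (LBINT t=0..x. sin (pi / 2 * t\<^sup>2))"

definition theta_tilde :: "real \<Rightarrow> complex" where
  "theta_tilde y = 1 / 2 - (1 - \<i>) / 2 *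
      (complex_of_real (fresnelC (- y / sqrt pi)) + \<i> * complex_of_real (fresnelS (- y / sqrt pi)))"

definition e_leak :: "real \<Rightarrow> real \<Rightarrow> real" where
  "e_leak fD x = sqrt ((cmod (theta_tilde (x - sqrt fD)))\<^sup>2 + (cmod (theta_tilde (- x - sqrt fD)))\<^sup>2)"

definition p_leak :: "real \<Rightarrow> real \<Rightarrow> real^'n \<Rightarrow> real" where
  "p_leak fr fD \<xi> = sqrt (\<Sum>j\<in>UNIV. (e_leak fD (\<xi> $ j / sqrt fr))\<^sup>2)"

definition cube :: "real \<Rightarrow> (real^'n) set" where
  "cube a = {x. \<forall>j. \<bar>x $ j\<bar> \<le> a}"

end

theory Submission
  imports Defs "HOL-Probability.Probability" "HOL-Complex_Analysis.Complex_Analysis"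
    "HOL-Real_Asymp.Real_Asymp"
begin

text \<open>The complement of the cube is the union of the half-spaces \<open>s x\<^sub>j > 1/2\<close> with \<open>s = 1\<close> or \<open>s = -1\<close>.
  On each of them only the part \<open>s x\<^sub>j > \<Delta>\<close> of the Fresnel kernel can reach a point from the support
  of \<open>h\<close>, and the Fourier transform of that part is the multiplier of the propagator times a
  translate of \<open>\<theta>\<close>. Hence there the propagated function coincides with the inverse transform of
  \<open>m \<theta> \<F>(h)\<close>, and since the inverse transform is an \<open>L\<^sup>2\<close> contraction, the energy in the half-space is
  at most \<open>\<parallel>\<theta> \<F>(h)\<parallel>\<^sup>2\<close>.

  Because the kernel is not integrable, the support statement is proved on the frequency side:
  \<open>m (1 - \<theta>)\<close> is a bounded pointwise limit of truncated Fresnel integrals, hence of Riemann sums,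
  which are linear combinations of the characters \<open>exp(-i \<xi> \<bullet> a)\<close>, that is of translations. Only the
  contraction property of the Fourier transform is needed, not Plancherel's identity.\<close>

section \<open>Gaussian integrals\<close>

lemma lborel_integral_prod_Basis:
  fixes f :: "'a::euclidean_space \<Rightarrow> real \<Rightarrow> complex"
  assumes "\<And>b. b \<in> Basis \<Longrightarrow> integrable lborel (f b)"
  shows "integrable lborel (\<lambda>x::'a. \<Prod>b\<in>Basis. f b (x \<bullet> b))"
    and "(LINT x|lborel. (\<Prod>b\<in>Basis. f b ((x::'a) \<bullet> b))) = (\<Prod>b\<in>Basis. LINT t|lborel. f b t)"
proof -
  interpret product_sigma_finite "\<lambda>_::'a. lborel :: real measure"
    by standard
  have [measurable]: "\<And>b. b \<in> Basis \<Longrightarrow> f b \<in> borel_measurable borel"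
    using borel_measurable_integrable[OF assms] by simp
  have m: "(\<lambda>x::'a. \<Prod>b\<in>Basis. f b (x \<bullet> b)) \<in> borel_measurable borel"
    by measurable
  have "integrable (\<Pi>\<^sub>M b\<in>(Basis::'a set). lborel) (\<lambda>x. \<Prod>b\<in>Basis. f b (x b))"
    by (rule product_integrable_prod) (auto intro: assms)
  then show "integrable lborel (\<lambda>x::'a. \<Prod>b\<in>Basis. f b (x \<bullet> b))"
    by (subst lborel_eq, subst integrable_distr_eq) (use m in \<open>auto cong: prod.cong\<close>)
  have "(LINT x|lborel. (\<Prod>b\<in>Basis. f b ((x::'a) \<bullet> b)))
      = (LINT x|(\<Pi>\<^sub>M b\<in>(Basis::'a set). lborel). (\<Prod>b\<in>Basis. f b (x b)))"
    by (subst lborel_eq, subst integral_distr) (use m in \<open>auto cong: prod.cong\<close>)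
  also have "\<dots> = (\<Prod>b\<in>Basis. LINT t|lborel. f b t)"
    by (rule product_integral_prod) (auto intro: assms)
  finally show "(LINT x|lborel. (\<Prod>b\<in>Basis. f b ((x::'a) \<bullet> b))) = (\<Prod>b\<in>Basis. LINT t|lborel. f b t)" .
qed

lemma cis_sum: "finite A \<Longrightarrow> cis (sum f A) = (\<Prod>x\<in>A. cis (f x))"
  by (induction A rule: finite_induct) (auto simp flip: cis_mult)

lemma borel_measurable_cis [measurable]: "cis \<in> borel_measurable borel"
  by (intro borel_measurable_continuous_onI continuous_on_cis continuous_on_id)

lemma borel_measurable_cnj [measurable]: "cnj \<in> borel_measurable borel"
  by (intro borel_measurable_continuous_onI continuous_intros)

lemma gaussian_fourier_real:
  fixes a t :: real
  assumes "a > 0"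
  shows "integrable lborel (\<lambda>x. cis (t * x) * complex_of_real (exp (- a * x\<^sup>2 / 2)))"
    and "(LINT x|lborel. cis (t * x) * complex_of_real (exp (- a * x\<^sup>2 / 2)))
      = complex_of_real (sqrt (2 * pi / a) * exp (- t\<^sup>2 / (2 * a)))"
proof -
  let ?g = "\<lambda>u x. cis (u * x) * complex_of_real (exp (- x\<^sup>2 / 2))"
  have dens: "std_normal_density x *\<^sub>R iexp (u * x) = ?g u x / complex_of_real (sqrt (2 * pi))" for u x
    by (simp add: normal_density_def cis_conv_exp scaleR_conv_of_real field_simps)
  have int0: "integrable lborel (?g u)" for u
  proof -
    have "integrable lborel (\<lambda>x. sqrt (2 * pi) * std_normal_density x)"
      by (intro integrable_mult_right) simp
    then have "integrable lborel (\<lambda>x. exp (- x\<^sup>2 / 2) :: real)"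
      by (simp add: normal_density_def)
    then show ?thesis
      by (rule Bochner_Integration.integrable_bound) (auto simp: norm_mult)
  qed
  have val0: "(LINT x|lborel. ?g u x) = complex_of_real (sqrt (2 * pi) * exp (- u\<^sup>2 / 2))" for u
  proof -
    have "complex_of_real (exp (- u\<^sup>2 / 2)) = char std_normal_distribution u"
      by (simp add: char_std_normal_distribution)
    also have "\<dots> = (LINT x|lborel. std_normal_density x *\<^sub>R iexp (u * x))"
      unfolding char_def by (subst integral_density) auto
    also have "\<dots> = (LINT x|lborel. ?g u x / complex_of_real (sqrt (2 * pi)))"
      by (simp only: dens)
    also have "\<dots> = (LINT x|lborel. ?g u x) / complex_of_real (sqrt (2 * pi))"
      by simp
    finally show ?thesis
      by (simp add: field_simps del: of_real_exp)
  qed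
  let ?r = "sqrt a"
  have r: "?r > 0" "?r\<^sup>2 = a"
    using assms by auto
  have eq: "?g (t / ?r) (0 + ?r * x) = cis (t * x) * complex_of_real (exp (- a * x\<^sup>2 / 2))" for x
    using r by (simp add: power_mult_distrib del: of_real_exp)
  show "integrable lborel (\<lambda>x. cis (t * x) * complex_of_real (exp (- a * x\<^sup>2 / 2)))"
    using lborel_integrable_real_affine[OF int0, of ?r "t / ?r" 0] r by (simp only: eq)
  have "(LINT x|lborel. ?g (t / ?r) x)
      = \<bar>?r\<bar> *\<^sub>R (LINT x|lborel. cis (t * x) * complex_of_real (exp (- a * x\<^sup>2 / 2)))"
    by (subst lborel_integral_real_affine[where c = ?r and t = 0]) (use r in simp, simp only: eq)
  then have "complex_of_real ?r * (LINT x|lborel. cis (t * x) * complex_of_real (exp (- a * x\<^sup>2 / 2)))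
     = complex_of_real (sqrt (2 * pi) * exp (- (t / ?r)\<^sup>2 / 2))"
    using r val0[of "t / ?r"] by (simp add: scaleR_conv_of_real)
  then have "(LINT x|lborel. cis (t * x) * complex_of_real (exp (- a * x\<^sup>2 / 2)))
     = complex_of_real (sqrt (2 * pi) * exp (- (t / ?r)\<^sup>2 / 2)) / complex_of_real ?r"
    using r by (simp add: field_simps del: of_real_exp)
  also have "\<dots> = complex_of_real (sqrt (2 * pi) * exp (- (t / ?r)\<^sup>2 / 2) / ?r)"
    by (simp del: of_real_exp)
  also have "sqrt (2 * pi) * exp (- (t / ?r)\<^sup>2 / 2) / ?r = sqrt (2 * pi / a) * exp (- t\<^sup>2 / (2 * a))"
    using r by (simp add: power_divide real_sqrt_divide real_sqrt_mult mult.commute)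
  finally show "(LINT x|lborel. cis (t * x) * complex_of_real (exp (- a * x\<^sup>2 / 2)))
      = complex_of_real (sqrt (2 * pi / a) * exp (- t\<^sup>2 / (2 * a)))" .
qed

lemma gaussian_fourier:
  fixes a s :: real and z :: "'a::euclidean_space"
  assumes "a > 0" and "\<bar>s\<bar> = 1"
  shows "integrable lborel (\<lambda>x. cis (s * (x \<bullet> z)) * complex_of_real (exp (- a * (norm x)\<^sup>2 / 2)))"
    and "(LINT x|lborel. cis (s * (x \<bullet> z)) * complex_of_real (exp (- a * (norm x)\<^sup>2 / 2)))
      = complex_of_real ((2 * pi / a) powr (DIM('a) / 2) * exp (- (norm z)\<^sup>2 / (2 * a)))"
proof -
  let ?f = "\<lambda>b t. cis ((s * (z \<bullet> b)) * t) * complex_of_real (exp (- a * t\<^sup>2 / 2))"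
  have nrm: "(norm y)\<^sup>2 = (\<Sum>b\<in>Basis. (y \<bullet> b)\<^sup>2)" for y :: 'a
    by (simp add: power2_norm_eq_inner euclidean_inner[of y y] flip: power2_eq_square)
  have eq: "(\<Prod>b\<in>Basis. ?f b (x \<bullet> b))
      = cis (s * (x \<bullet> z)) * complex_of_real (exp (- a * (norm x)\<^sup>2 / 2))" for x :: 'a
  proof -
    have "s * (x \<bullet> z) = (\<Sum>b\<in>Basis. (s * (z \<bullet> b)) * (x \<bullet> b))"
      by (simp add: euclidean_inner[of x z] sum_distrib_left mult_ac)
    moreover have "- a * (norm x)\<^sup>2 / 2 = (\<Sum>b\<in>Basis. - a * (x \<bullet> b)\<^sup>2 / 2)"
      by (simp add: nrm sum_distrib_left sum_divide_distrib sum_negf)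
    ultimately show ?thesis
      by (simp add: cis_sum exp_sum prod.distrib del: of_real_exp)
  qed
  have i: "integrable lborel (?f b)" for b
    using assms by (intro gaussian_fourier_real)
  show "integrable lborel (\<lambda>x. cis (s * (x \<bullet> z)) * complex_of_real (exp (- a * (norm x)\<^sup>2 / 2)))"
    using lborel_integral_prod_Basis(1)[of ?f, OF i] by (simp only: eq)
  have "(LINT x|lborel. cis (s * (x \<bullet> z)) * complex_of_real (exp (- a * (norm x)\<^sup>2 / 2)))
      = (\<Prod>b\<in>(Basis::'a set). LINT t|lborel. ?f b t)"
    using lborel_integral_prod_Basis(2)[of ?f, OF i] by (simp only: eq)
  also have "\<dots> = (\<Prod>b\<in>(Basis::'a set). complex_of_real (sqrt (2 * pi / a) * exp (- (z \<bullet> b)\<^sup>2 / (2 * a))))"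
    using assms(2)
    by (intro prod.cong refl, subst gaussian_fourier_real(2)[OF assms(1)])
       (auto simp: power_mult_distrib abs_if split: if_splits)
  also have "\<dots> = complex_of_real ((\<Prod>b\<in>(Basis::'a set). sqrt (2 * pi / a)) * exp (\<Sum>b\<in>Basis. - (z \<bullet> b)\<^sup>2 / (2 * a)))"
    by (simp add: exp_sum prod.distrib del: of_real_exp)
  also have "(\<Prod>b\<in>(Basis::'a set). sqrt (2 * pi / a)) = (2 * pi / a) powr (DIM('a) / 2)"
    using assms by (simp add: powr_half_sqrt[symmetric] powr_powr powr_realpow[symmetric])
  also have "(\<Sum>b\<in>Basis. - (z \<bullet> b)\<^sup>2 / (2 * a)) = - (norm z)\<^sup>2 / (2 * a)"
    by (simp add: nrm sum_divide_distrib sum_negf)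
  finally show "(LINT x|lborel. cis (s * (x \<bullet> z)) * complex_of_real (exp (- a * (norm x)\<^sup>2 / 2)))
      = complex_of_real ((2 * pi / a) powr (DIM('a) / 2) * exp (- (norm z)\<^sup>2 / (2 * a)))" .
qed

lemma gaussian_integral:
  fixes a :: real
  assumes "a > 0"
  shows "integrable lborel (\<lambda>x::'a::euclidean_space. exp (- a * (norm x)\<^sup>2 / 2))"
    and "(\<integral>\<^sup>+ x. ennreal (exp (- a * (norm (x::'a))\<^sup>2 / 2)) \<partial>lborel) = ennreal ((2 * pi / a) powr (DIM('a) / 2))"
proof -
  note g = gaussian_fourier[OF assms, of 1 "0::'a", simplified, folded of_real_exp]
  show i: "integrable lborel (\<lambda>x::'a. exp (- a * (norm x)\<^sup>2 / 2))"
    using integrable_Re[OF g(1)] by simp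
  have "(LINT x::'a|lborel. exp (- a * (norm x)\<^sup>2 / 2)) = (2 * pi / a) powr (DIM('a) / 2)"
    using g(2) by (simp del: of_real_exp)
  then show "(\<integral>\<^sup>+ x. ennreal (exp (- a * (norm (x::'a))\<^sup>2 / 2)) \<partial>lborel) = ennreal ((2 * pi / a) powr (DIM('a) / 2))"
    by (subst nn_integral_eq_integral[OF i]) auto
qed

lemma integrable_pair_product:
  fixes f :: "'a \<Rightarrow> complex" and g :: "'b \<Rightarrow> complex"
  assumes "sigma_finite_measure M" "sigma_finite_measure N" "integrable M f" "integrable N g"
  shows "integrable (M \<Otimes>\<^sub>M N) (\<lambda>(x, y). f x * g y)"
    and "(LINT p|(M \<Otimes>\<^sub>M N). f (fst p) * g (snd p)) = (LINT x|M. f x) * (LINT y|N. g y)"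
proof -
  interpret pair_sigma_finite M N
    using assms by (simp add: pair_sigma_finite_def)
  have [measurable]: "f \<in> borel_measurable M" "g \<in> borel_measurable N"
    using assms by auto
  show *: "integrable (M \<Otimes>\<^sub>M N) (\<lambda>(x, y). f x * g y)"
    by (rule Fubini_integrable) (use assms in \<open>auto simp: norm_mult\<close>)
  show "(LINT p|(M \<Otimes>\<^sub>M N). f (fst p) * g (snd p)) = (LINT x|M. f x) * (LINT y|N. g y)"
    using integral_fst'[OF *] by (simp add: case_prod_beta')
qed

lemma nn_integral_le_of_AE_tendsto:
  fixes u :: "nat \<Rightarrow> 'a \<Rightarrow> ennreal"
  assumes "\<And>n. u n \<in> borel_measurable M"
    and "AE x in M. (\<lambda>n. u n x) \<longlonglongrightarrow> v x"
    and "\<forall>\<^sub>F n in sequentially. (\<integral>\<^sup>+ x. u n x \<partial>M) \<le> c"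
  shows "(\<integral>\<^sup>+ x. v x \<partial>M) \<le> c"
proof -
  have "(\<integral>\<^sup>+ x. v x \<partial>M) = (\<integral>\<^sup>+ x. liminf (\<lambda>n. u n x) \<partial>M)"
    using assms(2) by (intro nn_integral_cong_AE) (auto simp: lim_imp_Liminf)
  also have "\<dots> \<le> liminf (\<lambda>n. \<integral>\<^sup>+ x. u n x \<partial>M)"
    by (rule nn_integral_liminf[OF assms(1)])
  also have "\<dots> \<le> limsup (\<lambda>n. \<integral>\<^sup>+ x. u n x \<partial>M)"
    by (rule Liminf_le_Limsup) simp
  also have "\<dots> \<le> c"
    by (rule Limsup_bounded[OF assms(3)])
  finally show ?thesis .
qed

lemma nn_integral_lborel_translate:
  fixes f :: "'a::euclidean_space \<Rightarrow> ennreal"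
  assumes [measurable]: "f \<in> borel_measurable borel"
  shows "(\<integral>\<^sup>+ x. f (x - c) \<partial>lborel) = (\<integral>\<^sup>+ x. f x \<partial>lborel)"
proof -
  have "(\<integral>\<^sup>+ x. f x \<partial>lborel) = (\<integral>\<^sup>+ x. f x \<partial>(distr lborel borel ((+) (- c))))"
    by (simp add: lborel_distr_plus)
  also have "\<dots> = (\<integral>\<^sup>+ x. f (x - c) \<partial>lborel)"
    by (subst nn_integral_distr) auto
  finally show ?thesis ..
qed

definition nsq :: "('a::euclidean_space \<Rightarrow> complex) \<Rightarrow> ennreal" where
  "nsq f = (\<integral>\<^sup>+ x. ennreal ((cmod (f x))\<^sup>2) \<partial>lborel)"

definition L2 :: "('a::euclidean_space \<Rightarrow> complex) \<Rightarrow> bool" where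
  "L2 f \<longleftrightarrow> f \<in> borel_measurable borel \<and> nsq f < \<infinity>"

lemma fourier_integral_measurable [measurable]:
  fixes f :: "real^'n \<Rightarrow> complex"
  assumes [measurable]: "f \<in> borel_measurable borel"
  shows "fourier_integral s f \<in> borel_measurable borel"
proof -
  have "fourier_integral s f \<in> borel_measurable lborel"
    unfolding fourier_integral_def[abs_def] by measurable
  then show ?thesis by simp
qed

lemma integrable_cis_mult:
  fixes f :: "real^'n \<Rightarrow> complex"
  assumes "integrable lborel f"
  shows "integrable lborel (\<lambda>x. cis (s * (\<xi> \<bullet> x)) * f x)"
proof (rule Bochner_Integration.integrable_bound[OF assms])
  have [measurable]: "f \<in> borel_measurable borel"
    using assms by auto
  show "(\<lambda>x. cis (s * (\<xi> \<bullet> x)) * f x) \<in> borel_measurable lborel"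
    by measurable
qed (simp add: norm_mult)

section \<open>The contraction property of the Fourier integral\<close>

lemma cmod_fourier_integral_damped:
  fixes f :: "real^'n \<Rightarrow> complex"
  assumes f: "integrable lborel f" and "a > 0" and "\<bar>s\<bar> = 1"
  shows "(\<integral>\<^sup>+ \<xi>. ennreal (exp (- a * (norm \<xi>)\<^sup>2 / 2) * (cmod (fourier_integral s f \<xi>))\<^sup>2) \<partial>lborel) \<le> nsq f"
proof -
  define N where "N = (2 * pi) powr (- real CARD('n) / 2)"
  define c where "c = (2 * pi / a) powr (real CARD('n) / 2)"
  define d where "d = (2 * pi * a) powr (real CARD('n) / 2)"
  define e where "e = (\<lambda>\<xi>::real^'n. exp (- a * (norm \<xi>)\<^sup>2 / 2))"
  define q where "q = (\<lambda>z::real^'n. exp (- (norm z)\<^sup>2 / (2 * a)))"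
  define K where "K = (\<lambda>(p::(real^'n) \<times> (real^'n)) \<xi>. (f (fst p) * cnj (f (snd p))) *
      (cis (s * (\<xi> \<bullet> (fst p - snd p))) * complex_of_real (e \<xi>)))"
  have Ncd: "N\<^sup>2 * c * d = 1"
  proof -
    have "N\<^sup>2 = (2 * pi) powr (- real CARD('n))"
      by (simp add: N_def powr_powr flip: powr_numeral)
    moreover have "c * d = (2 * pi / a * (2 * pi * a)) powr (real CARD('n) / 2)"
      unfolding c_def d_def using assms(2) by (subst powr_mult) auto
    moreover have "2 * pi / a * (2 * pi * a) = (2 * pi) powr 2"
      using assms(2) by (simp add: power2_eq_square)
    ultimately have "N\<^sup>2 * (c * d) = (2 * pi) powr (- real CARD('n)) * (2 * pi) powr real CARD('n)"
      by (simp only: powr_powr) simp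
    then show ?thesis
      by (simp only: mult.assoc flip: powr_add) simp
  qed
  have [measurable]: "f \<in> borel_measurable borel"
    using f by auto
  have [measurable]: "e \<in> borel_measurable borel" "q \<in> borel_measurable borel"
    unfolding e_def q_def by measurable
  have e_int: "integrable lborel e"
    unfolding e_def using assms(2) by (rule gaussian_integral)
  have e_pos: "e x > 0" "q x > 0" for x
    by (auto simp: e_def q_def)
  have cnj_int: "integrable lborel (\<lambda>x. cnj (f x))"
    using f by simp
  have ff: "integrable (lborel \<Otimes>\<^sub>M lborel) (\<lambda>p. f (fst p) * cnj (f (snd p)))"
    using integrable_pair_product(1)[OF sigma_finite_lborel sigma_finite_lborel f cnj_int]
    by (simp add: case_prod_beta')
  have K_meas [measurable]: "case_prod K \<in> borel_measurable ((lborel \<Otimes>\<^sub>M lborel) \<Otimes>\<^sub>M lborel)"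
    unfolding K_def by measurable
  have e_int': "integrable lborel (\<lambda>x. complex_of_real (e x))"
    using e_int by simp
  have sf: "sigma_finite_measure (lborel \<Otimes>\<^sub>M lborel :: ((real^'n) \<times> (real^'n)) measure)"
    by (simp add: lborel_prod sigma_finite_lborel)
  interpret P: pair_sigma_finite "lborel \<Otimes>\<^sub>M lborel :: ((real^'n) \<times> (real^'n)) measure" "lborel :: (real^'n) measure"
    using sf sigma_finite_lborel by (simp add: pair_sigma_finite_def)
  have K_int: "integrable ((lborel \<Otimes>\<^sub>M lborel) \<Otimes>\<^sub>M lborel) (case_prod K)"
  proof (rule Bochner_Integration.integrable_bound)
    show "integrable ((lborel \<Otimes>\<^sub>M lborel) \<Otimes>\<^sub>M lborel)
        (\<lambda>(p, \<xi>). (f (fst p) * cnj (f (snd p))) * complex_of_real (e \<xi>))"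
      by (rule integrable_pair_product[OF sf sigma_finite_lborel ff e_int'])
    show "AE x in (lborel \<Otimes>\<^sub>M lborel) \<Otimes>\<^sub>M lborel. norm (case_prod K x)
        \<le> norm (case x of (p, \<xi>) \<Rightarrow> (f (fst p) * cnj (f (snd p))) * complex_of_real (e \<xi>))"
      by (auto simp: K_def norm_mult)
  qed (rule K_meas)
  have inner: "complex_of_real (e \<xi> * (cmod (fourier_integral s f \<xi>))\<^sup>2)
      = complex_of_real (N\<^sup>2) * (LINT p|(lborel \<Otimes>\<^sub>M lborel). K p \<xi>)" for \<xi>
  proof -
    let ?A = "\<lambda>x. cis (s * (\<xi> \<bullet> x)) * f x"
    have A: "integrable lborel ?A" "integrable lborel (\<lambda>x. cnj (?A x))"
      by (simp_all only: complex_integrable_cnj integrable_cis_mult[OF f])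
    have K_eq: "K p \<xi> = complex_of_real (e \<xi>) * (?A (fst p) * cnj (?A (snd p)))" for p
    proof -
      have "cis (s * (\<xi> \<bullet> (fst p - snd p))) = cis (s * (\<xi> \<bullet> fst p)) * cnj (cis (s * (\<xi> \<bullet> snd p)))"
        by (simp add: cis_cnj cis_mult inner_diff_right right_diff_distrib)
      then show ?thesis
        by (simp add: K_def)
    qed
    have "(LINT p|(lborel \<Otimes>\<^sub>M lborel). K p \<xi>) = complex_of_real (e \<xi>) * (LINT p|(lborel \<Otimes>\<^sub>M lborel). ?A (fst p) * cnj (?A (snd p)))"
      by (simp only: K_eq integral_mult_right_zero)
    also have "(LINT p|(lborel \<Otimes>\<^sub>M lborel). ?A (fst p) * cnj (?A (snd p))) = (LINT x|lborel. ?A x) * cnj (LINT x|lborel. ?A x)"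
      using integrable_pair_product(2)[OF sigma_finite_lborel sigma_finite_lborel A]
      by (simp only: Bochner_Integration.integral_cnj)
    also have "\<dots> = complex_of_real ((cmod (LINT x|lborel. ?A x))\<^sup>2)"
      by (metis complex_norm_square)
    finally show ?thesis
      by (simp add: fourier_integral_def N_def norm_mult power_mult_distrib)
  qed
  have outer: "(LINT \<xi>|lborel. K p \<xi>) = f (fst p) * cnj (f (snd p)) * complex_of_real (c * q (fst p - snd p))" for p
    unfolding K_def e_def q_def c_def
    using gaussian_fourier(2)[OF assms(2,3), of "fst p - snd p"]
    by (subst integral_mult_right_zero) (simp del: of_real_exp)
  have int1: "integrable lborel (\<lambda>\<xi>. e \<xi> * (cmod (fourier_integral s f \<xi>))\<^sup>2)"
  proof -
    have "integrable lborel (\<lambda>\<xi>. complex_of_real (N\<^sup>2) * (LINT p|(lborel \<Otimes>\<^sub>M lborel). K p \<xi>))"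
      using P.integrable_snd[OF K_int] by (intro integrable_mult_right) simp
    then have "integrable lborel (\<lambda>\<xi>. complex_of_real (e \<xi> * (cmod (fourier_integral s f \<xi>))\<^sup>2))"
      by (simp only: inner)
    then show ?thesis
      by (simp only: complex_of_real_integrable_eq)
  qed
  have "complex_of_real (LINT \<xi>|lborel. e \<xi> * (cmod (fourier_integral s f \<xi>))\<^sup>2)
      = (LINT \<xi>|lborel. complex_of_real (N\<^sup>2) * (LINT p|(lborel \<Otimes>\<^sub>M lborel). K p \<xi>))"
    by (simp only: integral_complex_of_real flip: inner)
  also have "\<dots> = complex_of_real (N\<^sup>2) * (LINT p|(lborel \<Otimes>\<^sub>M lborel). LINT \<xi>|lborel. K p \<xi>)"
    using P.Fubini_integral[OF K_int] by (simp only: integral_mult_right_zero)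
  also have "\<dots> = (LINT p|(lborel \<Otimes>\<^sub>M lborel). complex_of_real (N\<^sup>2) * (f (fst p) * cnj (f (snd p)) * complex_of_real (c * q (fst p - snd p))))"
    by (simp only: outer integral_mult_right_zero)
  finally have eq: "complex_of_real (LINT \<xi>|lborel. e \<xi> * (cmod (fourier_integral s f \<xi>))\<^sup>2) = \<dots>" .
  have nn_q: "(\<integral>\<^sup>+ x. ennreal (q (x - y)) \<partial>lborel) = ennreal d" for y
  proof -
    have "(\<integral>\<^sup>+ x. ennreal (q (x - y)) \<partial>lborel) = (\<integral>\<^sup>+ x. ennreal (q x) \<partial>lborel)"
      by (rule nn_integral_lborel_translate) measurable
    also have "\<dots> = ennreal d"
      using gaussian_integral(2)[of "1 / a", where 'a = "real^'n"] assms(2)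
      by (simp add: q_def d_def mult.commute[of a 2])
    finally show ?thesis .
  qed
  have q_sym: "q (x - y) = q (y - x)" for x y
    by (simp add: q_def norm_minus_commute)
  have "(\<integral>\<^sup>+ \<xi>. ennreal (e \<xi> * (cmod (fourier_integral s f \<xi>))\<^sup>2) \<partial>lborel)
      = ennreal (LINT \<xi>|lborel. e \<xi> * (cmod (fourier_integral s f \<xi>))\<^sup>2)"
    by (intro nn_integral_eq_integral[OF int1]) (simp add: e_def)
  also have "\<dots> \<le> ennreal (cmod (complex_of_real (LINT \<xi>|lborel. e \<xi> * (cmod (fourier_integral s f \<xi>))\<^sup>2)))"
    by (intro ennreal_leI) simp
  also have "\<dots> \<le> (\<integral>\<^sup>+ p. ennreal (cmod (complex_of_real (N\<^sup>2) * (f (fst p) * cnj (f (snd p)) * complex_of_real (c * q (fst p - snd p))))) \<partial>(lborel \<Otimes>\<^sub>M lborel))"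
    unfolding eq
    by (intro integral_norm_bound_ennreal integrable_mult_right)
       (use P.integrable_fst[OF K_int] in \<open>simp only: outer\<close>)
  also have "\<dots> \<le> (\<integral>\<^sup>+ p. ennreal (N\<^sup>2 * c / 2) * (ennreal ((cmod (f (fst p)))\<^sup>2) * ennreal (q (snd p - fst p))
        + ennreal ((cmod (f (snd p)))\<^sup>2) * ennreal (q (fst p - snd p))) \<partial>(lborel \<Otimes>\<^sub>M lborel))"
  proof (intro nn_integral_mono)
    fix p :: "(real^'n) \<times> (real^'n)"
    let ?x = "cmod (f (fst p))" and ?y = "cmod (f (snd p))" and ?q = "q (fst p - snd p)"
    have cpos: "c \<ge> 0" by (simp add: c_def)
    have "cmod (complex_of_real (N\<^sup>2) * (f (fst p) * cnj (f (snd p)) * complex_of_real (c * ?q)))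
        = (N\<^sup>2 * c / 2 * ?q) * (2 * ?x * ?y)"
      using e_pos(2)[of "fst p - snd p"] cpos by (simp add: norm_mult norm_power)
    also have "\<dots> \<le> (N\<^sup>2 * c / 2 * ?q) * (?x\<^sup>2 + ?y\<^sup>2)"
      using e_pos(2)[of "fst p - snd p"] cpos
      by (intro mult_left_mono sum_squares_bound) (auto intro: mult_nonneg_nonneg)
    also have "\<dots> = (N\<^sup>2 * c / 2) * (?x\<^sup>2 * q (snd p - fst p) + ?y\<^sup>2 * ?q)"
      by (simp add: q_sym[of "snd p"] algebra_simps)
    finally have "cmod (complex_of_real (N\<^sup>2) * (f (fst p) * cnj (f (snd p)) * complex_of_real (c * ?q)))
      \<le> (N\<^sup>2 * c / 2) * (?x\<^sup>2 * q (snd p - fst p) + ?y\<^sup>2 * ?q)" .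
    from ennreal_leI[OF this]
    show "ennreal (cmod (complex_of_real (N\<^sup>2) * (f (fst p) * cnj (f (snd p)) * complex_of_real (c * ?q))))
      \<le> ennreal (N\<^sup>2 * c / 2) * (ennreal (?x\<^sup>2) * ennreal (q (snd p - fst p)) + ennreal (?y\<^sup>2) * ennreal ?q)"
      using e_pos(2)[of "snd p - fst p", THEN less_imp_le] e_pos(2)[of "fst p - snd p", THEN less_imp_le] cpos
      by (simp only: ennreal_mult ennreal_plus zero_le_power2 mult_nonneg_nonneg add_nonneg_nonneg divide_nonneg_nonneg zero_le_numeral)
  qed
  also have "\<dots> = ennreal (N\<^sup>2 * c / 2) *
      ((\<integral>\<^sup>+ p. ennreal ((cmod (f (fst p)))\<^sup>2) * ennreal (q (snd p - fst p)) \<partial>(lborel \<Otimes>\<^sub>M lborel))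
        + (\<integral>\<^sup>+ p. ennreal ((cmod (f (snd p)))\<^sup>2) * ennreal (q (fst p - snd p)) \<partial>(lborel \<Otimes>\<^sub>M lborel)))"
    by (simp add: nn_integral_cmult nn_integral_add)
  also have "(\<integral>\<^sup>+ p. ennreal ((cmod (f (fst p)))\<^sup>2) * ennreal (q (snd p - fst p)) \<partial>(lborel \<Otimes>\<^sub>M lborel))
      = (\<integral>\<^sup>+ x. \<integral>\<^sup>+ y. ennreal ((cmod (f x))\<^sup>2) * ennreal (q (y - x)) \<partial>lborel \<partial>lborel)"
    by (subst lborel.nn_integral_fst[symmetric]) auto
  also have "(\<integral>\<^sup>+ p. ennreal ((cmod (f (snd p)))\<^sup>2) * ennreal (q (fst p - snd p)) \<partial>(lborel \<Otimes>\<^sub>M lborel))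
      = (\<integral>\<^sup>+ y. \<integral>\<^sup>+ x. ennreal ((cmod (f y))\<^sup>2) * ennreal (q (x - y)) \<partial>lborel \<partial>lborel)"
    by (subst lborel_pair.nn_integral_snd[symmetric]) auto
  also have "(\<integral>\<^sup>+ x. \<integral>\<^sup>+ y. ennreal ((cmod (f x))\<^sup>2) * ennreal (q (y - x)) \<partial>lborel \<partial>lborel) = nsq f * ennreal d"
    by (simp add: nn_integral_cmult nn_integral_multc nn_q nsq_def)
  also have "ennreal (N\<^sup>2 * c / 2) * (nsq f * ennreal d + nsq f * ennreal d) = ennreal (N\<^sup>2 * c * d) * nsq f"
  proof -
    have "ennreal (N\<^sup>2 * c / 2) * (nsq f * ennreal d + nsq f * ennreal d)
        = (ennreal (N\<^sup>2 * c / 2) * (2 * ennreal d)) * nsq f"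
      by (simp add: algebra_simps mult_2)
    also have "ennreal (N\<^sup>2 * c / 2) * (2 * ennreal d) = ennreal (N\<^sup>2 * c * d)"
      using ennreal_mult[of "N\<^sup>2 * c / 2" "2 * d"] ennreal_mult[of 2 d]
      by (simp add: c_def d_def mult.assoc)
    finally show ?thesis .
  qed
  finally show ?thesis
    using Ncd by (simp add: e_def)
qed

lemma nsq_fourier_integral_le:
  fixes f :: "real^'n \<Rightarrow> complex"
  assumes f: "integrable lborel f" and s: "\<bar>s\<bar> = 1"
  shows "nsq (fourier_integral s f) \<le> nsq f"
proof -
  have [measurable]: "f \<in> borel_measurable borel"
    using f by auto
  let ?u = "\<lambda>n \<xi>. ennreal (exp (- (1 / real (Suc n)) * (norm \<xi>)\<^sup>2 / 2) * (cmod (fourier_integral s f \<xi>))\<^sup>2)"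
  have lim: "(\<lambda>n. ?u n \<xi>) \<longlonglongrightarrow> ennreal ((cmod (fourier_integral s f \<xi>))\<^sup>2)" for \<xi>
  proof -
    have "(\<lambda>n. exp (- (1 / real (Suc n)) * (norm \<xi>)\<^sup>2 / 2) * (cmod (fourier_integral s f \<xi>))\<^sup>2)
        \<longlonglongrightarrow> exp (- 0 * (norm \<xi>)\<^sup>2 / 2) * (cmod (fourier_integral s f \<xi>))\<^sup>2"
      by (intro tendsto_intros LIMSEQ_inverse_real_of_nat[unfolded inverse_eq_divide]) auto
    then show ?thesis
      by (intro tendsto_ennrealI) simp
  qed
  show ?thesis
    unfolding nsq_def[of "fourier_integral s f"]
  proof (rule nn_integral_le_of_AE_tendsto)
    show "?u n \<in> borel_measurable lborel" for n
      by measurable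
    show "AE \<xi> in lborel. (\<lambda>n. ?u n \<xi>) \<longlonglongrightarrow> ennreal ((cmod (fourier_integral s f \<xi>))\<^sup>2)"
      using lim by (intro AE_I2)
    show "\<forall>\<^sub>F n in sequentially. (\<integral>\<^sup>+ \<xi>. ?u n \<xi> \<partial>lborel) \<le> nsq f"
      by (intro always_eventually allI cmod_fourier_integral_damped[OF f _ s]) simp
  qed
qed

lemma fourier_integral_damped_inverse:
  fixes f :: "real^'n \<Rightarrow> complex"
  assumes f: "integrable lborel f" and a: "a > 0"
  shows "fourier_integral 1 (\<lambda>\<xi>. complex_of_real (exp (- a * (norm \<xi>)\<^sup>2 / 2)) * fourier_integral (-1) f \<xi>) x
    = complex_of_real ((2 * pi * a) powr (- real CARD('n) / 2)) *
        (LINT y|lborel. complex_of_real (exp (- (norm (x - y))\<^sup>2 / (2 * a))) * f y)"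
proof -
  define N where "N = (2 * pi) powr (- real CARD('n) / 2)"
  define c where "c = (2 * pi / a) powr (real CARD('n) / 2)"
  define e where "e = (\<lambda>\<xi>::real^'n. exp (- a * (norm \<xi>)\<^sup>2 / 2))"
  define K where "K = (\<lambda>y \<xi>. f y * (cis (1 * (\<xi> \<bullet> (x - y))) * complex_of_real (e \<xi>)))"
  have Nc: "N\<^sup>2 * c = (2 * pi * a) powr (- real CARD('n) / 2)"
  proof -
    have "N\<^sup>2 = (2 * pi) powr (- real CARD('n))"
      by (simp add: N_def powr_powr flip: powr_numeral)
    moreover have "c = (2 * pi) powr (real CARD('n) / 2) * a powr (- real CARD('n) / 2)"
      using a unfolding c_def by (subst powr_divide) (auto simp: powr_minus_divide)
    ultimately have "N\<^sup>2 * c = (2 * pi) powr (- real CARD('n) + real CARD('n) / 2) * a powr (- real CARD('n) / 2)"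
      by (simp only: powr_add mult.assoc)
    also have "- real CARD('n) + real CARD('n) / 2 = - real CARD('n) / 2"
      by simp
    finally show ?thesis
      using a by (simp only: powr_mult)
  qed
  have [measurable]: "f \<in> borel_measurable borel"
    using f by auto
  have [measurable]: "e \<in> borel_measurable borel"
    unfolding e_def by measurable
  have e_int: "integrable lborel (\<lambda>x. complex_of_real (e x))"
    unfolding e_def complex_of_real_integrable_eq using a by (rule gaussian_integral)
  have K_int: "integrable (lborel \<Otimes>\<^sub>M lborel) (case_prod K)"
  proof (rule Bochner_Integration.integrable_bound)
    show "integrable (lborel \<Otimes>\<^sub>M lborel) (\<lambda>(y, \<xi>). f y * complex_of_real (e \<xi>))"
      by (rule integrable_pair_product[OF sigma_finite_lborel sigma_finite_lborel f e_int])
    show "case_prod K \<in> borel_measurable (lborel \<Otimes>\<^sub>M lborel)"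
      unfolding K_def by measurable
  qed (auto simp: K_def norm_mult)
  have inner: "cis (1 * (x \<bullet> \<xi>)) * (complex_of_real (e \<xi>) * fourier_integral (-1) f \<xi>)
      = complex_of_real N * (LINT y|lborel. K y \<xi>)" for \<xi>
  proof -
    have "K y \<xi> = (cis (x \<bullet> \<xi>) * complex_of_real (e \<xi>)) * (cis (- 1 * (\<xi> \<bullet> y)) * f y)" for y
    proof -
      have "cis (\<xi> \<bullet> (x - y)) = cis (x \<bullet> \<xi>) * cis (- (\<xi> \<bullet> y))"
        by (simp add: cis_mult inner_diff_right inner_commute[of x])
      then show ?thesis
        by (simp add: K_def)
    qed
    then have "(LINT y|lborel. K y \<xi>) = (cis (x \<bullet> \<xi>) * complex_of_real (e \<xi>)) * (LINT y|lborel. cis (- 1 * (\<xi> \<bullet> y)) * f y)"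
      by (simp only: integral_mult_right_zero)
    then show ?thesis
      by (simp add: fourier_integral_def N_def)
  qed
  have outer: "(LINT \<xi>|lborel. K y \<xi>) = complex_of_real c * (complex_of_real (exp (- (norm (x - y))\<^sup>2 / (2 * a))) * f y)" for y
    unfolding K_def e_def c_def
    using gaussian_fourier(2)[OF a, of 1 "x - y"]
    by (subst integral_mult_right_zero) (simp del: of_real_exp)
  have "fourier_integral 1 (\<lambda>\<xi>. complex_of_real (e \<xi>) * fourier_integral (-1) f \<xi>) x
    = complex_of_real N * (complex_of_real N * (LINT \<xi>|lborel. LINT y|lborel. K y \<xi>))"
    unfolding fourier_integral_def[of 1] inner by (simp add: N_def)
  also have "(LINT \<xi>|lborel. LINT y|lborel. K y \<xi>) = (LINT y|lborel. LINT \<xi>|lborel. K y \<xi>)"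
    by (rule lborel_pair.Fubini_integral[OF K_int])
  also have "complex_of_real N * (complex_of_real N * \<dots>) = complex_of_real (N\<^sup>2 * c) *
        (LINT y|lborel. complex_of_real (exp (- (norm (x - y))\<^sup>2 / (2 * a))) * f y)"
    unfolding outer integral_mult_right_zero by (simp add: power2_eq_square)
  finally show ?thesis
    by (simp only: Nc e_def)
qed

section \<open>The Fourier transform on square-integrable functions\<close>

lemma L2_measurable: "L2 f \<Longrightarrow> f \<in> borel_measurable borel"
  by (simp add: L2_def)

lemma nsq_cong_AE: "AE x in lborel. f x = g x \<Longrightarrow> nsq f = nsq g"
  unfolding nsq_def by (rule nn_integral_cong_AE) auto

lemma nsq_mono: "(\<And>x. cmod (f x) \<le> cmod (g x)) \<Longrightarrow> nsq f \<le> nsq g"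
  unfolding nsq_def by (intro nn_integral_mono ennreal_leI power_mono) auto

lemma nsq_diff_commute: "nsq (\<lambda>x. f x - g x) = nsq (\<lambda>x. g x - f x)"
  by (simp add: nsq_def norm_minus_commute)

lemma nsq_add_le_weighted:
  assumes [measurable]: "f \<in> borel_measurable borel" "g \<in> borel_measurable borel" and d: "d > 0"
  shows "nsq (\<lambda>x. f x + g x) \<le> ennreal (1 + d) * nsq f + ennreal (1 + 1 / d) * nsq g"
proof -
  have "ennreal ((cmod (f x + g x))\<^sup>2)
      \<le> ennreal (1 + d) * ennreal ((cmod (f x))\<^sup>2) + ennreal (1 + 1 / d) * ennreal ((cmod (g x))\<^sup>2)" for x
  proof -
    let ?a = "cmod (f x)" and ?b = "cmod (g x)"
    have "2 * (sqrt d * ?a) * (?b / sqrt d) \<le> (sqrt d * ?a)\<^sup>2 + (?b / sqrt d)\<^sup>2"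
      by (rule sum_squares_bound)
    then have *: "2 * ?a * ?b \<le> d * ?a\<^sup>2 + ?b\<^sup>2 / d"
      using d by (simp add: power_mult_distrib power_divide)
    have "(cmod (f x + g x))\<^sup>2 \<le> (?a + ?b)\<^sup>2"
      by (intro power_mono norm_triangle_ineq) auto
    also have "\<dots> \<le> (1 + d) * ?a\<^sup>2 + (1 + 1 / d) * ?b\<^sup>2"
      using * by (simp add: power2_sum algebra_simps)
    finally show ?thesis
      using d by (simp add: ennreal_leI flip: ennreal_mult ennreal_plus)
  qed
  then have "nsq (\<lambda>x. f x + g x) \<le> (\<integral>\<^sup>+ x. ennreal (1 + d) * ennreal ((cmod (f x))\<^sup>2)
      + ennreal (1 + 1 / d) * ennreal ((cmod (g x))\<^sup>2) \<partial>lborel)"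
    unfolding nsq_def by (intro nn_integral_mono)
  also have "\<dots> = ennreal (1 + d) * nsq f + ennreal (1 + 1 / d) * nsq g"
    unfolding nsq_def by (simp add: nn_integral_cmult nn_integral_add)
  finally show ?thesis .
qed

lemma nsq_add_le:
  assumes "f \<in> borel_measurable borel" "g \<in> borel_measurable borel"
  shows "nsq (\<lambda>x. f x + g x) \<le> 2 * nsq f + 2 * nsq g"
  using nsq_add_le_weighted[OF assms, of 1] by simp

lemma nsq_cmult_bound:
  assumes [measurable]: "g \<in> borel_measurable borel" and "\<And>x. cmod (k x) \<le> B"
  shows "nsq (\<lambda>x. k x * g x) \<le> ennreal (B\<^sup>2) * nsq g"
proof -
  have "nsq (\<lambda>x. k x * g x) \<le> (\<integral>\<^sup>+ x. ennreal (B\<^sup>2) * ennreal ((cmod (g x))\<^sup>2) \<partial>lborel)"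
    unfolding nsq_def
  proof (intro nn_integral_mono)
    fix x
    have "(cmod (k x * g x))\<^sup>2 \<le> (B * cmod (g x))\<^sup>2"
      using assms(2) by (intro power_mono) (auto simp: norm_mult mult_right_mono)
    then show "ennreal ((cmod (k x * g x))\<^sup>2) \<le> ennreal (B\<^sup>2) * ennreal ((cmod (g x))\<^sup>2)"
      by (simp add: power_mult_distrib ennreal_leI flip: ennreal_mult)
  qed
  also have "\<dots> = ennreal (B\<^sup>2) * nsq g"
    unfolding nsq_def by (simp add: nn_integral_cmult)
  finally show ?thesis .
qed

lemma L2_cmult_bound:
  assumes "L2 g" "k \<in> borel_measurable borel" "\<And>x. cmod (k x) \<le> B"
  shows "L2 (\<lambda>x. k x * g x)"
proof -
  have [measurable]: "g \<in> borel_measurable borel" "k \<in> borel_measurable borel"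
    using assms by (auto simp: L2_def)
  have "nsq (\<lambda>x. k x * g x) \<le> ennreal (B\<^sup>2) * nsq g"
    by (rule nsq_cmult_bound) (use assms in auto)
  also have "\<dots> < \<infinity>"
    using assms(1) by (auto simp: L2_def ennreal_mult_less_top)
  finally show ?thesis
    by (simp add: L2_def)
qed

lemma L2_cmult: "L2 g \<Longrightarrow> L2 (\<lambda>x. c * g x)"
  by (rule L2_cmult_bound[where B = "cmod c"]) auto

lemma L2_add:
  assumes "L2 f" "L2 g"
  shows "L2 (\<lambda>x. f x + g x)"
proof -
  have [measurable]: "f \<in> borel_measurable borel" "g \<in> borel_measurable borel"
    using assms by (auto simp: L2_def)
  have "nsq (\<lambda>x. f x + g x) \<le> 2 * nsq f + 2 * nsq g"
    by (rule nsq_add_le) auto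
  also have "\<dots> < \<infinity>"
    using assms by (auto simp: L2_def ennreal_mult_less_top)
  finally show ?thesis
    by (simp add: L2_def)
qed

lemma L2_diff: "L2 f \<Longrightarrow> L2 g \<Longrightarrow> L2 (\<lambda>x. f x - g x)"
  using L2_add[of f "\<lambda>x. -1 * g x"] L2_cmult[of g "-1"] by simp

lemma nsq_eq_0_iff:
  assumes [measurable]: "f \<in> borel_measurable borel"
  shows "nsq f = 0 \<longleftrightarrow> (AE x in lborel. f x = 0)"
  unfolding nsq_def by (subst nn_integral_0_iff_AE) auto

lemma nsq_dominated_tendsto_0:
  fixes g :: "'a::euclidean_space \<Rightarrow> complex"
  assumes g: "L2 g" and k: "\<And>n. k n \<in> borel_measurable borel" and "\<And>n x. cmod (k n x) \<le> B"
    and lim: "\<And>x. (\<lambda>n. k n x) \<longlonglongrightarrow> 0"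
  shows "(\<lambda>n. nsq (\<lambda>x. k n x * g x)) \<longlonglongrightarrow> 0"
proof -
  note [measurable] = k L2_measurable[OF g]
  have "(\<lambda>n. \<integral>\<^sup>+ x. ennreal ((cmod (k n x * g x))\<^sup>2) \<partial>lborel) \<longlonglongrightarrow> (\<integral>\<^sup>+ (x::'a). 0 \<partial>lborel)"
  proof (rule nn_integral_dominated_convergence[where u' = "\<lambda>x. 0" and w = "\<lambda>x. ennreal (B\<^sup>2) * ennreal ((cmod (g x))\<^sup>2)"])
    show "AE x in lborel. ennreal ((cmod (k n x * g x))\<^sup>2) \<le> ennreal (B\<^sup>2) * ennreal ((cmod (g x))\<^sup>2)" for n
    proof (rule AE_I2)
      fix x
      have "(cmod (k n x * g x))\<^sup>2 \<le> (B * cmod (g x))\<^sup>2"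
        using assms(3) by (intro power_mono) (auto simp: norm_mult mult_right_mono)
      then show "ennreal ((cmod (k n x * g x))\<^sup>2) \<le> ennreal (B\<^sup>2) * ennreal ((cmod (g x))\<^sup>2)"
        by (simp add: power_mult_distrib ennreal_leI flip: ennreal_mult)
    qed
    have "(\<integral>\<^sup>+ x. ennreal (B\<^sup>2) * ennreal ((cmod (g x))\<^sup>2) \<partial>lborel) = ennreal (B\<^sup>2) * nsq g"
      unfolding nsq_def by (simp add: nn_integral_cmult)
    then show "(\<integral>\<^sup>+ x. ennreal (B\<^sup>2) * ennreal ((cmod (g x))\<^sup>2) \<partial>lborel) < \<infinity>"
      using g by (auto simp: L2_def ennreal_mult_less_top)
    show "AE x in lborel. (\<lambda>n. ennreal ((cmod (k n x * g x))\<^sup>2)) \<longlonglongrightarrow> 0"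
    proof (rule AE_I2)
      fix x
      have "(\<lambda>n. (cmod (k n x * g x))\<^sup>2) \<longlonglongrightarrow> (cmod (0 * g x))\<^sup>2"
        by (intro tendsto_intros lim)
      then have "(\<lambda>n. ennreal ((cmod (k n x * g x))\<^sup>2)) \<longlonglongrightarrow> ennreal ((cmod (0 * g x))\<^sup>2)"
        by (rule tendsto_ennrealI)
      then show "(\<lambda>n. ennreal ((cmod (k n x * g x))\<^sup>2)) \<longlonglongrightarrow> 0"
        by simp
    qed
  qed measurable
  then show ?thesis
    by (simp add: nsq_def)
qed

lemma sets_ball [measurable]: "ball c r \<in> sets borel"
  by simp

abbreviation trunc :: "real \<Rightarrow> ('a::euclidean_space \<Rightarrow> complex) \<Rightarrow> 'a \<Rightarrow> complex" where
  "trunc R f \<equiv> (\<lambda>x. indicator (ball 0 R) x * f x)"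

lemma L2_bounded_support_integrable:
  fixes f :: "'a::euclidean_space \<Rightarrow> complex"
  assumes f: "L2 f" and "\<And>x. x \<notin> ball 0 R \<Longrightarrow> f x = 0"
  shows "integrable lborel f"
proof -
  have [measurable]: "f \<in> borel_measurable borel"
    using f by (simp add: L2_def)
  have "(\<integral>\<^sup>+ x. ennreal (cmod (f x)) \<partial>lborel)
      \<le> (\<integral>\<^sup>+ x. indicator (ball 0 R) x + ennreal ((cmod (f x))\<^sup>2) \<partial>lborel)"
  proof (intro nn_integral_mono)
    fix x
    have "2 * cmod (f x) * 1 \<le> (cmod (f x))\<^sup>2 + 1\<^sup>2"
      by (rule sum_squares_bound)
    then have "cmod (f x) \<le> 1 + (cmod (f x))\<^sup>2"
      by (smt (verit) norm_ge_zero one_power2)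
    then show "ennreal (cmod (f x)) \<le> indicator (ball 0 R) x + ennreal ((cmod (f x))\<^sup>2)"
      using assms(2)[of x]
      by (cases "x \<in> ball 0 R") (auto simp: ennreal_leI simp flip: ennreal_1 ennreal_plus)
  qed
  also have "\<dots> = emeasure lborel (ball (0::'a) R) + nsq f"
    by (subst nn_integral_add) (auto intro!: borel_measurable_indicator simp: nsq_def)
  also have "\<dots> < \<infinity>"
    using f emeasure_lborel_ball_finite[of "0::'a" R] by (auto simp: L2_def)
  finally show ?thesis
    by (simp add: integrable_iff_bounded)
qed

lemma L2_trunc: "L2 f \<Longrightarrow> L2 (trunc R f)"
  by (rule L2_cmult_bound[where B = 1]) (auto intro!: borel_measurable_indicator split: split_indicator)

lemma integrable_trunc: "L2 f \<Longrightarrow> integrable lborel (trunc R f)"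
  by (rule L2_bounded_support_integrable[where R = R]) (auto intro: L2_trunc)

lemma nsq_tail_tendsto_0:
  assumes "L2 f"
  shows "((\<lambda>R. nsq (\<lambda>x. f x - trunc R f x)) \<longlongrightarrow> 0) at_top"
proof -
  have seq: "(\<lambda>n. nsq (\<lambda>x. f x - trunc (real n) f x)) \<longlonglongrightarrow> 0"
  proof -
    have "(\<lambda>n. nsq (\<lambda>x. (1 - indicator (ball 0 (real n)) x) * f x)) \<longlonglongrightarrow> 0"
    proof (rule nsq_dominated_tendsto_0[OF assms, where B = 1])
      show "(\<lambda>n. 1 - indicator (ball 0 (real n)) x :: complex) \<longlonglongrightarrow> 0" for x :: 'a
      proof (rule tendsto_eventually)
        show "\<forall>\<^sub>F n in sequentially. 1 - indicator (ball 0 (real n)) x = (0::complex)"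
          using eventually_gt_at_top[of "nat \<lceil>norm x\<rceil>"]
          by eventually_elim (auto split: split_indicator, linarith)
      qed
    qed (auto intro!: borel_measurable_diff borel_measurable_indicator split: split_indicator)
    then show ?thesis
      by (simp add: left_diff_distrib)
  qed
  show ?thesis
  proof (rule order_tendstoI)
    fix e :: ennreal assume "0 < e"
    then obtain n where n: "nsq (\<lambda>x. f x - trunc (real n) f x) < e"
      using order_tendstoD(2)[OF seq, of e] by (auto simp: eventually_sequentially)
    show "\<forall>\<^sub>F R in at_top. nsq (\<lambda>x. f x - trunc R f x) < e"
      using eventually_ge_at_top[of "real n"]
    proof eventually_elim
      case (elim R)
      have "nsq (\<lambda>x. f x - trunc R f x) \<le> nsq (\<lambda>x. f x - trunc (real n) f x)"
        using elim by (intro nsq_mono) (auto split: split_indicator)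
      with n show ?case by simp
    qed
  qed simp
qed

lemma ennreal_tendsto_0_le:
  fixes u v :: "'a \<Rightarrow> ennreal"
  assumes "\<And>x. u x \<le> v x" and "(v \<longlongrightarrow> l) F" and "l = 0"
  shows "(u \<longlongrightarrow> 0) F"
  by (rule tendsto_sandwich[OF _ _ tendsto_const assms(2)[unfolded assms(3)]]) (simp_all add: assms(1))

lemma ennreal_le_limit:
  fixes u :: "'a \<Rightarrow> ennreal"
  assumes "\<And>n. x \<le> u n" and "(u \<longlongrightarrow> l) F" and "F \<noteq> bot"
  shows "x \<le> l"
  by (rule tendsto_lowerbound[OF assms(2) _ assms(3)]) (simp add: assms(1))

definition is_fourier :: "real \<Rightarrow> (real^'n \<Rightarrow> complex) \<Rightarrow> (real^'n \<Rightarrow> complex) \<Rightarrow> bool" where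
  "is_fourier s f G \<longleftrightarrow> G \<in> borel_measurable borel \<and>
     ((\<lambda>R. nsq (\<lambda>\<xi>. fourier_integral s (trunc R f) \<xi> - G \<xi>)) \<longlongrightarrow> 0) at_top"

lemma fourier_L2_eq: "fourier_L2 s f = (SOME G. is_fourier s f G)"
  by (simp add: fourier_L2_def is_fourier_def nsq_def)

lemma fourier_integral_add:
  assumes "integrable lborel f" "integrable lborel g"
  shows "fourier_integral s (\<lambda>x. f x + g x) \<xi> = fourier_integral s f \<xi> + fourier_integral s g \<xi>"
  using integrable_cis_mult[OF assms(1), of s \<xi>] integrable_cis_mult[OF assms(2), of s \<xi>]
  by (simp add: fourier_integral_def distrib_left)

lemma fourier_integral_cmult:
  "fourier_integral s (\<lambda>x. c * f x) \<xi> = c * fourier_integral s f \<xi>"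
proof -
  have "(LINT x|lborel. cis (s * (\<xi> \<bullet> x)) * (c * f x)) = (LINT x|lborel. c * (cis (s * (\<xi> \<bullet> x)) * f x))"
    by (simp add: mult_ac)
  then show ?thesis
    by (simp add: fourier_integral_def)
qed

lemma fourier_integral_diff:
  assumes "integrable lborel f" "integrable lborel g"
  shows "fourier_integral s (\<lambda>x. f x - g x) \<xi> = fourier_integral s f \<xi> - fourier_integral s g \<xi>"
  using fourier_integral_add[OF assms(1) integrable_mult_right[OF assms(2), of "-1"], of s \<xi>]
    fourier_integral_cmult[of s "-1" g \<xi>] by simp

lemma is_fourier_integrable:
  fixes f :: "real^'n \<Rightarrow> complex"
  assumes f: "L2 f" and i: "integrable lborel f" and s: "\<bar>s\<bar> = 1"
  shows "is_fourier s f (fourier_integral s f)"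
proof -
  have [measurable]: "f \<in> borel_measurable borel"
    using f by (simp add: L2_def)
  have "nsq (\<lambda>\<xi>. fourier_integral s (trunc R f) \<xi> - fourier_integral s f \<xi>) \<le> nsq (\<lambda>x. f x - trunc R f x)" for R
  proof -
    have "nsq (\<lambda>\<xi>. fourier_integral s (trunc R f) \<xi> - fourier_integral s f \<xi>)
        = nsq (fourier_integral s (\<lambda>x. trunc R f x - f x))"
      by (intro arg_cong[where f = nsq] ext) (simp add: fourier_integral_diff integrable_trunc f i)
    also have "\<dots> \<le> nsq (\<lambda>x. trunc R f x - f x)"
      by (intro nsq_fourier_integral_le s Bochner_Integration.integrable_diff integrable_trunc f i)
    finally show ?thesis
      by (simp add: nsq_diff_commute)
  qed
  then have "((\<lambda>R. nsq (\<lambda>\<xi>. fourier_integral s (trunc R f) \<xi> - fourier_integral s f \<xi>)) \<longlongrightarrow> 0) at_top"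
    by (rule ennreal_tendsto_0_le[OF _ nsq_tail_tendsto_0[OF f] refl])
  then show ?thesis
    by (simp add: is_fourier_def)
qed

lemma is_fourier_unique:
  fixes f :: "real^'n \<Rightarrow> complex"
  assumes f: "f \<in> borel_measurable borel" and "is_fourier s f G" "is_fourier s f H"
  shows "AE x in lborel. G x = H x"
proof -
  let ?F = "\<lambda>R. fourier_integral s (trunc R f)"
  have [measurable]: "f \<in> borel_measurable borel" "G \<in> borel_measurable borel" "H \<in> borel_measurable borel"
    using assms by (auto simp: is_fourier_def)
  have "nsq (\<lambda>x. G x - H x) \<le> 2 * nsq (\<lambda>\<xi>. ?F R \<xi> - G \<xi>) + 2 * nsq (\<lambda>\<xi>. ?F R \<xi> - H \<xi>)" for R
  proof -
    have "nsq (\<lambda>\<xi>. (G \<xi> - ?F R \<xi>) + (?F R \<xi> - H \<xi>)) \<le> 2 * nsq (\<lambda>\<xi>. G \<xi> - ?F R \<xi>) + 2 * nsq (\<lambda>\<xi>. ?F R \<xi> - H \<xi>)"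
      by (rule nsq_add_le) measurable
    then show ?thesis
      by (simp add: nsq_diff_commute[of G "?F R"])
  qed
  moreover have "((\<lambda>R. 2 * nsq (\<lambda>\<xi>. ?F R \<xi> - G \<xi>) + 2 * nsq (\<lambda>\<xi>. ?F R \<xi> - H \<xi>)) \<longlongrightarrow> 2 * 0 + 2 * 0) at_top"
    using assms by (intro tendsto_add ennreal_tendsto_cmult) (auto simp: is_fourier_def)
  ultimately have "nsq (\<lambda>x. G x - H x) \<le> 2 * 0 + 2 * 0"
    by (rule ennreal_le_limit) simp
  then have "nsq (\<lambda>x. G x - H x) = 0"
    by simp
  then show ?thesis
    by (subst (asm) nsq_eq_0_iff) auto
qed

lemma is_fourier_add:
  fixes f :: "real^'n \<Rightarrow> complex"
  assumes "L2 f" "L2 g" "is_fourier s f F" "is_fourier s g G"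
  shows "is_fourier s (\<lambda>x. f x + g x) (\<lambda>x. F x + G x)"
proof -
  note [measurable] = L2_measurable[OF assms(1)] L2_measurable[OF assms(2)]
  have [measurable]: "F \<in> borel_measurable borel" "G \<in> borel_measurable borel"
    using assms by (auto simp: is_fourier_def)
  let ?F = "\<lambda>R. fourier_integral s (trunc R f)" and ?G = "\<lambda>R. fourier_integral s (trunc R g)"
  have "nsq (\<lambda>\<xi>. fourier_integral s (trunc R (\<lambda>x. f x + g x)) \<xi> - (F \<xi> + G \<xi>))
      \<le> 2 * nsq (\<lambda>\<xi>. ?F R \<xi> - F \<xi>) + 2 * nsq (\<lambda>\<xi>. ?G R \<xi> - G \<xi>)" for R
  proof -
    have eq: "fourier_integral s (trunc R (\<lambda>x. f x + g x)) \<xi> - (F \<xi> + G \<xi>) = (?F R \<xi> - F \<xi>) + (?G R \<xi> - G \<xi>)" for \<xi>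
      using fourier_integral_add[OF integrable_trunc[OF assms(1)] integrable_trunc[OF assms(2)], of s R R \<xi>]
      by (simp add: distrib_left)
    show ?thesis
      unfolding eq by (rule nsq_add_le) measurable
  qed
  moreover have "((\<lambda>R. 2 * nsq (\<lambda>\<xi>. ?F R \<xi> - F \<xi>) + 2 * nsq (\<lambda>\<xi>. ?G R \<xi> - G \<xi>)) \<longlongrightarrow> 2 * 0 + 2 * 0) at_top"
    using assms by (intro tendsto_add ennreal_tendsto_cmult) (auto simp: is_fourier_def)
  ultimately have "((\<lambda>R. nsq (\<lambda>\<xi>. fourier_integral s (trunc R (\<lambda>x. f x + g x)) \<xi> - (F \<xi> + G \<xi>))) \<longlongrightarrow> 0) at_top"
    by (rule ennreal_tendsto_0_le) simp
  then show ?thesis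
    by (simp add: is_fourier_def)
qed

lemma is_fourier_cmult:
  fixes f :: "real^'n \<Rightarrow> complex"
  assumes [measurable]: "f \<in> borel_measurable borel" and "is_fourier s f F"
  shows "is_fourier s (\<lambda>x. c * f x) (\<lambda>x. c * F x)"
proof -
  have [measurable]: "F \<in> borel_measurable borel"
    using assms by (auto simp: is_fourier_def)
  have "nsq (\<lambda>\<xi>. fourier_integral s (trunc R (\<lambda>x. c * f x)) \<xi> - c * F \<xi>)
     \<le> ennreal ((cmod c)\<^sup>2) * nsq (\<lambda>\<xi>. fourier_integral s (trunc R f) \<xi> - F \<xi>)" for R
  proof -
    have "fourier_integral s (trunc R (\<lambda>x. c * f x)) \<xi> = c * fourier_integral s (trunc R f) \<xi>" for \<xi>
      by (simp add: mult.left_commute[of _ c] fourier_integral_cmult)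
    then have eq: "fourier_integral s (trunc R (\<lambda>x. c * f x)) \<xi> - c * F \<xi> = c * (fourier_integral s (trunc R f) \<xi> - F \<xi>)" for \<xi>
      by (simp add: right_diff_distrib)
    show ?thesis
      unfolding eq by (rule nsq_cmult_bound[OF _ order_refl]) measurable
  qed
  moreover have "((\<lambda>R. ennreal ((cmod c)\<^sup>2) * nsq (\<lambda>\<xi>. fourier_integral s (trunc R f) \<xi> - F \<xi>)) \<longlongrightarrow> ennreal ((cmod c)\<^sup>2) * 0) at_top"
    using assms(2) by (intro ennreal_tendsto_cmult) (auto simp: is_fourier_def)
  ultimately have "((\<lambda>R. nsq (\<lambda>\<xi>. fourier_integral s (trunc R (\<lambda>x. c * f x)) \<xi> - c * F \<xi>)) \<longlongrightarrow> 0) at_top"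
    by (rule ennreal_tendsto_0_le) simp
  then show ?thesis
    by (simp add: is_fourier_def)
qed

lemma is_fourier_translate:
  fixes f :: "real^'n \<Rightarrow> complex"
  assumes f: "f \<in> borel_measurable borel" and F: "is_fourier 1 f F"
  shows "is_fourier 1 (\<lambda>\<xi>. cis (- (\<xi> \<bullet> a)) * f \<xi>) (\<lambda>x. F (x - a))"
proof -
  have [measurable]: "F \<in> borel_measurable borel" "f \<in> borel_measurable borel"
    using assms by (auto simp: is_fourier_def)
  have "fourier_integral 1 (trunc R (\<lambda>\<xi>. cis (- (\<xi> \<bullet> a)) * f \<xi>)) x = fourier_integral 1 (trunc R f) (x - a)" for R x
  proof -
    have "cis (1 * (x \<bullet> \<xi>)) * trunc R (\<lambda>\<xi>. cis (- (\<xi> \<bullet> a)) * f \<xi>) \<xi> = cis (1 * ((x - a) \<bullet> \<xi>)) * trunc R f \<xi>" for \<xi>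
      by (simp add: cis_mult inner_diff_left inner_commute[of a] mult.left_commute[of "cis _" "indicator _ _"] mult.assoc[symmetric])
    then show ?thesis
      by (simp only: fourier_integral_def)
  qed
  moreover have "nsq (\<lambda>x. fourier_integral 1 (trunc R f) (x - a) - F (x - a)) = nsq (\<lambda>x. fourier_integral 1 (trunc R f) x - F x)" for R
    unfolding nsq_def
    by (rule nn_integral_lborel_translate[of "\<lambda>x. ennreal ((cmod (fourier_integral 1 (trunc R f) x - F x))\<^sup>2)"]) measurable
  ultimately show ?thesis
    using F by (simp add: is_fourier_def)
qed

lemma nsq_is_fourier_le:
  fixes f :: "real^'n \<Rightarrow> complex"
  assumes f: "L2 f" and F: "is_fourier s f F" and s: "\<bar>s\<bar> = 1"
  shows "nsq F \<le> nsq f"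
proof -
  have [measurable]: "F \<in> borel_measurable borel" "f \<in> borel_measurable borel"
    using assms by (auto simp: is_fourier_def L2_def)
  have *: "nsq F \<le> ennreal (1 + d) * nsq f" if d: "d > 0" for d
  proof -
    let ?F = "\<lambda>R. fourier_integral s (trunc R f)"
    have "nsq F \<le> ennreal (1 + d) * nsq f + ennreal (1 + 1 / d) * nsq (\<lambda>\<xi>. ?F R \<xi> - F \<xi>)" for R
    proof -
      have "nsq F \<le> ennreal (1 + d) * nsq (?F R) + ennreal (1 + 1 / d) * nsq (\<lambda>\<xi>. F \<xi> - ?F R \<xi>)"
      proof -
        have "nsq (\<lambda>\<xi>. ?F R \<xi> + (F \<xi> - ?F R \<xi>)) \<le> ennreal (1 + d) * nsq (?F R) + ennreal (1 + 1 / d) * nsq (\<lambda>\<xi>. F \<xi> - ?F R \<xi>)"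
          by (rule nsq_add_le_weighted[OF _ _ d]) measurable
        then show ?thesis
          by simp
      qed
      also have "nsq (?F R) \<le> nsq (trunc R f)"
        by (intro nsq_fourier_integral_le integrable_trunc f s)
      also have "nsq (trunc R f) \<le> nsq f"
        by (intro nsq_mono) (auto split: split_indicator)
      finally show ?thesis
        by (simp add: nsq_diff_commute[of F] add_mono mult_left_mono)
    qed
    moreover have "((\<lambda>R. ennreal (1 + d) * nsq f + ennreal (1 + 1 / d) * nsq (\<lambda>\<xi>. ?F R \<xi> - F \<xi>))
        \<longlongrightarrow> ennreal (1 + d) * nsq f + ennreal (1 + 1 / d) * 0) at_top"
      using F by (intro tendsto_add ennreal_tendsto_cmult tendsto_const) (auto simp: is_fourier_def)
    ultimately have "nsq F \<le> ennreal (1 + d) * nsq f + ennreal (1 + 1 / d) * 0"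
      by (rule ennreal_le_limit) simp
    then show ?thesis
      by simp
  qed
  have "(\<lambda>n. ennreal (1 + 1 / real (Suc n)) * nsq f) \<longlonglongrightarrow> ennreal (1 + 0) * nsq f"
    using f
    by (intro tendsto_mult_ennreal tendsto_ennrealI tendsto_add tendsto_const
          LIMSEQ_inverse_real_of_nat[unfolded inverse_eq_divide]) (auto simp: L2_def)
  then have "nsq F \<le> ennreal (1 + 0) * nsq f"
    by (rule ennreal_le_limit[rotated]) (use * in auto)
  then show ?thesis
    by simp
qed

lemma nsq_trunc_diff_le:
  assumes "R \<le> R'"
  shows "nsq (\<lambda>x. trunc R f x - trunc R' f x) \<le> nsq (\<lambda>x. f x - trunc R f x)"
  using assms by (intro nsq_mono) (auto split: split_indicator)

lemma convergent_of_summable_weighted_increments: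
  fixes u :: "nat \<Rightarrow> complex"
  assumes "summable (\<lambda>k. 2 ^ k * (cmod (u (Suc k) - u k))\<^sup>2)"
  shows "convergent u"
proof -
  define C where "C = (\<Sum>k. 2 ^ k * (cmod (u (Suc k) - u k))\<^sup>2)"
  have bound: "cmod (u (Suc k) - u k) \<le> sqrt C * (1 / sqrt 2) ^ k" for k
  proof -
    have "(\<Sum>i\<in>{k}. 2 ^ i * (cmod (u (Suc i) - u i))\<^sup>2) \<le> C"
      unfolding C_def by (rule sum_le_suminf[OF assms]) auto
    then have "(cmod (u (Suc k) - u k))\<^sup>2 \<le> C / 2 ^ k"
      by (simp add: field_simps)
    then have "cmod (u (Suc k) - u k) \<le> sqrt (C / 2 ^ k)"
      by (rule real_le_rsqrt)
    then show ?thesis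
      by (simp add: real_sqrt_divide real_sqrt_power power_divide)
  qed
  have "summable (\<lambda>k. sqrt C * (1 / sqrt 2) ^ k)"
    by (intro summable_mult summable_geometric) (simp add: real_less_rsqrt)
  then have "summable (\<lambda>k. u (Suc k) - u k)"
    by (rule summable_comparison_test'[where N = 0]) (rule bound)
  then have "(\<lambda>n. \<Sum>k<n. u (Suc k) - u k) \<longlonglongrightarrow> (\<Sum>k. u (Suc k) - u k)"
    by (rule summable_LIMSEQ)
  then have "(\<lambda>n. u n - u 0) \<longlonglongrightarrow> (\<Sum>k. u (Suc k) - u k)"
    by (simp only: sum_lessThan_telescope)
  then have "(\<lambda>n. (u n - u 0) + u 0) \<longlonglongrightarrow> (\<Sum>k. u (Suc k) - u k) + u 0"
    by (intro tendsto_add tendsto_const)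
  then show ?thesis
    by (auto simp: convergent_def)
qed

lemma is_fourier_exists:
  fixes f :: "real^'n \<Rightarrow> complex"
  assumes f: "L2 f" and s: "\<bar>s\<bar> = 1"
  shows "\<exists>G. is_fourier s f G"
proof -
  note [measurable] = L2_measurable[OF f]
  define T where "T = (\<lambda>R. nsq (\<lambda>x. f x - trunc R f x))"
  have T: "(T \<longlongrightarrow> 0) at_top"
    unfolding T_def by (rule nsq_tail_tendsto_0[OF f])
  have "\<exists>R\<ge>real k. T R \<le> ennreal ((1 / 4) ^ k)" for k
  proof -
    have "\<forall>\<^sub>F R in at_top. T R < ennreal ((1 / 4) ^ k)"
      by (rule order_tendstoD[OF T]) simp
    then have "\<forall>\<^sub>F R in at_top. real k \<le> R \<and> T R \<le> ennreal ((1 / 4) ^ k)"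
      using eventually_ge_at_top[of "real k"] by eventually_elim auto
    then show ?thesis
      by (auto simp: eventually_at_top_linorder)
  qed
  then obtain r where r: "\<And>k. real k \<le> r k" "\<And>k. T (r k) \<le> ennreal ((1 / 4) ^ k)"
    by metis
  define u where "u = (\<lambda>R. fourier_integral s (trunc R f))"
  have [measurable]: "u R \<in> borel_measurable borel" for R
    unfolding u_def by measurable
  have u_diff: "nsq (\<lambda>x. u R x - u R' x) \<le> T R" if "R \<le> R'" for R R'
  proof -
    have "nsq (\<lambda>x. u R x - u R' x) = nsq (fourier_integral s (\<lambda>x. trunc R f x - trunc R' f x))"
      unfolding u_def by (intro arg_cong[where f = nsq] ext) (simp add: fourier_integral_diff integrable_trunc f)
    also have "\<dots> \<le> nsq (\<lambda>x. trunc R f x - trunc R' f x)"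
      by (intro nsq_fourier_integral_le s Bochner_Integration.integrable_diff integrable_trunc f)
    also have "\<dots> \<le> T R"
      unfolding T_def by (rule nsq_trunc_diff_le[OF that])
    finally show ?thesis .
  qed
  have u_step: "nsq (\<lambda>x. u (r (Suc k)) x - u (r k) x) \<le> ennreal ((1 / 4) ^ k)" for k
  proof (cases "r k \<le> r (Suc k)")
    case True
    then show ?thesis
      using u_diff[OF True] r(2)[of k] by (subst nsq_diff_commute) (rule order_trans)
  next
    case False
    have "ennreal ((1 / 4) ^ Suc k) \<le> ennreal ((1 / 4) ^ k)"
      by (intro ennreal_leI) simp
    with False show ?thesis
      using u_diff[of "r (Suc k)" "r k"] r(2)[of "Suc k"] by (meson linear order_trans)
  qed
  have "(\<integral>\<^sup>+ x. (\<Sum>k. ennreal (2 ^ k * (cmod (u (r (Suc k)) x - u (r k) x))\<^sup>2)) \<partial>lborel)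
      = (\<Sum>k. \<integral>\<^sup>+ x. ennreal (2 ^ k * (cmod (u (r (Suc k)) x - u (r k) x))\<^sup>2) \<partial>lborel)"
    by (rule nn_integral_suminf) measurable
  also have "\<dots> \<le> (\<Sum>k. ennreal ((1 / 2) ^ k))"
  proof (rule suminf_le)
    fix k
    have "(\<integral>\<^sup>+ x. ennreal (2 ^ k * (cmod (u (r (Suc k)) x - u (r k) x))\<^sup>2) \<partial>lborel)
        = ennreal (2 ^ k) * nsq (\<lambda>x. u (r (Suc k)) x - u (r k) x)"
      unfolding nsq_def by (subst nn_integral_cmult[symmetric]) (auto simp: ennreal_mult)
    also have "\<dots> \<le> ennreal (2 ^ k) * ennreal ((1 / 4) ^ k)"
      by (intro mult_left_mono u_step) simp
    also have "\<dots> = ennreal ((1 / 2) ^ k)"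
      by (simp flip: ennreal_mult power_mult_distrib)
    finally show "(\<integral>\<^sup>+ x. ennreal (2 ^ k * (cmod (u (r (Suc k)) x - u (r k) x))\<^sup>2) \<partial>lborel) \<le> ennreal ((1 / 2) ^ k)" .
  qed auto
  also have "\<dots> = ennreal (\<Sum>k. (1 / 2) ^ k)"
    by (rule suminf_ennreal2) (auto intro: summable_geometric)
  also have "\<dots> < \<infinity>"
    by simp
  finally have "AE x in lborel. (\<Sum>k. ennreal (2 ^ k * (cmod (u (r (Suc k)) x - u (r k) x))\<^sup>2)) \<noteq> \<infinity>"
    by (intro nn_integral_PInf_AE) auto
  then have conv: "AE x in lborel. convergent (\<lambda>k. u (r k) x)"
  proof eventually_elim
    case (elim x)
    then have "summable (\<lambda>k. 2 ^ k * (cmod (u (r (Suc k)) x - u (r k) x))\<^sup>2)"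
      by (intro summable_suminf_not_top) auto
    then show ?case
      by (rule convergent_of_summable_weighted_increments)
  qed
  define G where "G = (\<lambda>x. lim (\<lambda>k. u (r k) x))"
  have G_meas [measurable]: "G \<in> borel_measurable borel"
    unfolding G_def by measurable
  have lim: "AE x in lborel. (\<lambda>k. u (r k) x) \<longlonglongrightarrow> G x"
    using conv unfolding G_def by eventually_elim (simp add: convergent_LIMSEQ_iff)
  have "nsq (\<lambda>x. u R x - G x) \<le> T R" for R
    unfolding nsq_def
  proof (rule nn_integral_le_of_AE_tendsto)
    show "(\<lambda>x. ennreal ((cmod (u R x - u (r k) x))\<^sup>2)) \<in> borel_measurable lborel" for k
      by measurable
    show "AE x in lborel. (\<lambda>k. ennreal ((cmod (u R x - u (r k) x))\<^sup>2)) \<longlonglongrightarrow> ennreal ((cmod (u R x - G x))\<^sup>2)"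
      using lim by eventually_elim (intro tendsto_ennrealI tendsto_intros)
    show "\<forall>\<^sub>F k in sequentially. (\<integral>\<^sup>+ x. ennreal ((cmod (u R x - u (r k) x))\<^sup>2) \<partial>lborel) \<le> T R"
      using eventually_ge_at_top[of "nat \<lceil>R\<rceil>"]
    proof eventually_elim
      case (elim k)
      then have "R \<le> r k"
        using r(1)[of k] by linarith
      then show ?case
        using u_diff[of R "r k"] by (simp add: nsq_def)
    qed
  qed
  then have "((\<lambda>R. nsq (\<lambda>x. u R x - G x)) \<longlongrightarrow> 0) at_top"
    by (rule ennreal_tendsto_0_le[OF _ T refl])
  then have "is_fourier s f G"
    using G_meas unfolding is_fourier_def u_def by blast
  then show ?thesis
    by (rule exI[of "is_fourier s f" G])
qed

lemma is_fourier_fourier_L2: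
  fixes f :: "real^'n \<Rightarrow> complex"
  assumes "L2 f" "\<bar>s\<bar> = 1"
  shows "is_fourier s f (fourier_L2 s f)"
  unfolding fourier_L2_eq using is_fourier_exists[OF assms] by (rule someI_ex)

lemma fourier_L2_measurable:
  fixes f :: "real^'n \<Rightarrow> complex"
  assumes "L2 f" "\<bar>s\<bar> = 1"
  shows "fourier_L2 s f \<in> borel_measurable borel"
  using is_fourier_fourier_L2[OF assms] by (simp add: is_fourier_def)

lemma fourier_L2_AE_eq:
  fixes f :: "real^'n \<Rightarrow> complex"
  assumes "L2 f" "\<bar>s\<bar> = 1" "is_fourier s f F"
  shows "AE x in lborel. fourier_L2 s f x = F x"
  using is_fourier_unique[OF L2_measurable[OF assms(1)] is_fourier_fourier_L2[OF assms(1,2)] assms(3)] .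

lemma nsq_fourier_L2_le:
  fixes f :: "real^'n \<Rightarrow> complex"
  assumes "L2 f" "\<bar>s\<bar> = 1"
  shows "nsq (fourier_L2 s f) \<le> nsq f"
  by (rule nsq_is_fourier_le[OF assms(1) is_fourier_fourier_L2[OF assms] assms(2)])

lemma L2_fourier_L2:
  fixes f :: "real^'n \<Rightarrow> complex"
  assumes "L2 f" "\<bar>s\<bar> = 1"
  shows "L2 (fourier_L2 s f)"
  using nsq_fourier_L2_le[OF assms] assms(1) fourier_L2_measurable[OF assms]
  by (auto simp: L2_def)

lemma fourier_L2_diff_AE:
  fixes f g :: "real^'n \<Rightarrow> complex"
  assumes "L2 f" "L2 g" "\<bar>s\<bar> = 1"
  shows "AE x in lborel. fourier_L2 s (\<lambda>x. f x - g x) x = fourier_L2 s f x - fourier_L2 s g x"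
proof -
  have "is_fourier s (\<lambda>x. f x + - 1 * g x) (\<lambda>x. fourier_L2 s f x + - 1 * fourier_L2 s g x)"
    by (intro is_fourier_add is_fourier_cmult is_fourier_fourier_L2 L2_cmult L2_measurable assms)
  then show ?thesis
    using fourier_L2_AE_eq[OF L2_diff[OF assms(1,2)] assms(3), of "\<lambda>x. fourier_L2 s f x - fourier_L2 s g x"]
    by simp
qed

lemma fourier_L2_cong_AE:
  fixes f g :: "real^'n \<Rightarrow> complex"
  assumes [measurable]: "f \<in> borel_measurable borel" "g \<in> borel_measurable borel"
    and "AE x in lborel. f x = g x"
  shows "fourier_L2 s f = fourier_L2 s g"
proof -
  have "fourier_integral s (trunc R f) = fourier_integral s (trunc R g)" for R
  proof
    fix \<xi>
    show "fourier_integral s (trunc R f) \<xi> = fourier_integral s (trunc R g) \<xi>"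
      unfolding fourier_integral_def
      by (intro arg_cong2[where f = times] refl integral_cong_AE) (use assms(3) in \<open>measurable, auto\<close>)
  qed
  then show ?thesis
    by (simp add: fourier_L2_eq is_fourier_def)
qed

section \<open>Multipliers and half-space supports\<close>

text \<open>\<^term>\<open>g\<close> lives on the frequency side: its inverse transform vanishes beyond the hyperplane
  \<open>v \<bullet> x = c\<close>.\<close>

definition vanishes :: "real^'n \<Rightarrow> real \<Rightarrow> (real^'n \<Rightarrow> complex) \<Rightarrow> bool" where
  "vanishes v c g \<longleftrightarrow> L2 g \<and> (AE x in lborel. v \<bullet> x > c \<longrightarrow> fourier_L2 1 g x = 0)"

lemma vanishesI:
  assumes "L2 g" "is_fourier 1 g G" "AE x in lborel. v \<bullet> x > c \<longrightarrow> G x = 0"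
  shows "vanishes v c g"
  unfolding vanishes_def
proof
  show "AE x in lborel. v \<bullet> x > c \<longrightarrow> fourier_L2 1 g x = 0"
    using fourier_L2_AE_eq[OF assms(1) _ assms(2)] assms(3) by (auto elim: eventually_elim2)
qed (fact assms(1))

lemma vanishes_L2: "vanishes v c g \<Longrightarrow> L2 g"
  by (simp add: vanishes_def)

lemma vanishes_is_fourier: "vanishes v c g \<Longrightarrow> is_fourier 1 g (fourier_L2 1 g)"
  by (simp add: is_fourier_fourier_L2 vanishes_def)

lemma vanishes_mono: "vanishes v c g \<Longrightarrow> c \<le> c' \<Longrightarrow> vanishes v c' g"
  by (auto simp: vanishes_def elim: eventually_mono)

lemma vanishes_add:
  assumes "vanishes v c f" "vanishes v c g"
  shows "vanishes v c (\<lambda>x. f x + g x)"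
proof (rule vanishesI)
  show "is_fourier 1 (\<lambda>x. f x + g x) (\<lambda>x. fourier_L2 1 f x + fourier_L2 1 g x)"
    using assms by (intro is_fourier_add vanishes_is_fourier[where v = v and c = c] vanishes_L2[where v = v and c = c])
  show "AE x in lborel. v \<bullet> x > c \<longrightarrow> fourier_L2 1 f x + fourier_L2 1 g x = 0"
    using assms by (auto simp: vanishes_def elim: eventually_elim2)
qed (use assms in \<open>auto simp: vanishes_def L2_add\<close>)

lemma vanishes_cmult:
  assumes "vanishes v c f"
  shows "vanishes v c (\<lambda>x. k * f x)"
proof (rule vanishesI)
  show "is_fourier 1 (\<lambda>x. k * f x) (\<lambda>x. k * fourier_L2 1 f x)"
    using assms by (intro is_fourier_cmult vanishes_is_fourier[where v = v and c = c] L2_measurable vanishes_L2[where v = v and c = c])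
  show "AE x in lborel. v \<bullet> x > c \<longrightarrow> k * fourier_L2 1 f x = 0"
    using assms by (auto simp: vanishes_def elim: eventually_mono)
qed (use assms in \<open>auto simp: vanishes_def L2_cmult\<close>)

lemma AE_lborel_translate:
  fixes a :: "'a::euclidean_space"
  assumes "AE x in lborel. P x"
  shows "AE x in lborel. P (x - a)"
proof -
  have "AE x in distr lborel borel ((+) (- a)). P x"
    by (subst lborel_distr_plus) (rule assms)
  then have "AE x in lborel. P (- a + x)"
    by (rule AE_distrD[rotated]) simp
  then show ?thesis
    by simp
qed

lemma vanishes_translate:
  assumes "vanishes v c f"
  shows "vanishes v (c + v \<bullet> a) (\<lambda>\<xi>. cis (- (\<xi> \<bullet> a)) * f \<xi>)"
proof (rule vanishesI)
  show "L2 (\<lambda>\<xi>. cis (- (\<xi> \<bullet> a)) * f \<xi>)"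
    using vanishes_L2[OF assms] by (rule L2_cmult_bound[where B = 1]) auto
  show "is_fourier 1 (\<lambda>\<xi>. cis (- (\<xi> \<bullet> a)) * f \<xi>) (\<lambda>x. fourier_L2 1 f (x - a))"
    using assms by (intro is_fourier_translate vanishes_is_fourier[where v = v and c = c] L2_measurable vanishes_L2[where v = v and c = c])
  show "AE x in lborel. v \<bullet> x > c + v \<bullet> a \<longrightarrow> fourier_L2 1 f (x - a) = 0"
    using AE_lborel_translate[of "\<lambda>x. v \<bullet> x > c \<longrightarrow> fourier_L2 1 f x = 0" a] assms
    by (auto simp: vanishes_def inner_diff_right less_diff_eq elim: eventually_mono)
qed

lemma vanishes_limit:
  fixes g :: "real^'n \<Rightarrow> complex"
  assumes "\<And>n::nat. vanishes v c (f n)" and g: "L2 g"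
    and lim: "(\<lambda>n. nsq (\<lambda>x. f n x - g x)) \<longlonglongrightarrow> 0"
  shows "vanishes v c g"
proof -
  have fL: "L2 (f n)" for n
    using assms(1) vanishes_L2 by blast
  note [measurable] = fourier_L2_measurable[OF g, of 1, simplified]
  define H where "H = (\<lambda>x. indicator {x. v \<bullet> x > c} x * fourier_L2 1 g x)"
  have Hm [measurable]: "H \<in> borel_measurable borel"
    unfolding H_def by measurable
  have "nsq H \<le> nsq (\<lambda>x. f n x - g x)" for n
  proof -
    have "nsq H \<le> nsq (fourier_L2 1 (\<lambda>x. f n x - g x))"
      unfolding nsq_def
    proof (rule nn_integral_mono_AE)
      show "AE x in lborel. ennreal ((cmod (H x))\<^sup>2) \<le> ennreal ((cmod (fourier_L2 1 (\<lambda>x. f n x - g x) x))\<^sup>2)"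
        using fourier_L2_diff_AE[OF fL[of n] g, of 1, simplified] assms(1)[of n, unfolded vanishes_def, THEN conjunct2]
        by eventually_elim (auto simp: H_def norm_minus_commute split: split_indicator)
    qed
    also have "\<dots> \<le> nsq (\<lambda>x. f n x - g x)"
      by (rule nsq_fourier_L2_le) (simp_all add: L2_diff fL g)
    finally show ?thesis .
  qed
  then have "nsq H \<le> 0"
    by (rule ennreal_le_limit[OF _ lim]) simp
  then have "AE x in lborel. H x = 0"
    by (subst (asm) le_zero_eq, subst (asm) nsq_eq_0_iff) auto
  then show ?thesis
    using g unfolding vanishes_def by (auto simp: H_def elim: eventually_mono)
qed

text \<open>Fourier multipliers whose convolution kernel is carried by the half-space \<open>v \<bullet> x \<le> d\<close>,
  without ever speaking of the kernel, which need not be integrable.\<close>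

definition shift_multiplier :: "real^'n \<Rightarrow> real \<Rightarrow> (real^'n \<Rightarrow> complex) \<Rightarrow> bool" where
  "shift_multiplier v d k \<longleftrightarrow> k \<in> borel_measurable borel \<and> (\<exists>B. \<forall>\<xi>. cmod (k \<xi>) \<le> B) \<and>
     (\<forall>c g. vanishes v c g \<longrightarrow> vanishes v (c + d) (\<lambda>\<xi>. k \<xi> * g \<xi>))"

lemma shift_multiplier_cis:
  assumes "v \<bullet> a \<le> d"
  shows "shift_multiplier v d (\<lambda>\<xi>. cis (- (\<xi> \<bullet> a)))"
  unfolding shift_multiplier_def
proof (intro conjI allI impI)
  show "vanishes v (c + d) (\<lambda>\<xi>. cis (- (\<xi> \<bullet> a)) * g \<xi>)" if "vanishes v c g" for c g
    using vanishes_mono[OF vanishes_translate[OF that, of a], of "c + d"] assms by simp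
  show "\<exists>B. \<forall>\<xi>. cmod (cis (- (\<xi> \<bullet> a))) \<le> B"
    by (auto intro!: exI[of _ 1])
qed measurable

lemma shift_multiplier_cmult:
  assumes "shift_multiplier v d k"
  shows "shift_multiplier v d (\<lambda>\<xi>. b * k \<xi>)"
  unfolding shift_multiplier_def
proof (intro conjI allI impI)
  show "(\<lambda>\<xi>. b * k \<xi>) \<in> borel_measurable borel"
    using assms by (auto simp: shift_multiplier_def)
  obtain B where "\<And>\<xi>. cmod (k \<xi>) \<le> B"
    using assms by (auto simp: shift_multiplier_def)
  then show "\<exists>B. \<forall>\<xi>. cmod (b * k \<xi>) \<le> B"
    by (auto simp: norm_mult intro!: exI[of _ "cmod b * B"] mult_left_mono)
  show "vanishes v (c + d) (\<lambda>\<xi>. b * k \<xi> * g \<xi>)" if "vanishes v c g" for c g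
    using vanishes_cmult[of v "c + d" "\<lambda>\<xi>. k \<xi> * g \<xi>" b] assms that
    by (simp add: shift_multiplier_def mult.assoc)
qed

lemma shift_multiplier_zero: "shift_multiplier v d (\<lambda>\<xi>. 0)"
  unfolding shift_multiplier_def
proof (intro conjI allI impI)
  show "vanishes v (c + d) (\<lambda>\<xi>. 0 * g \<xi>)" if "vanishes v c g" for c g
  proof (rule vanishesI)
    show "L2 (\<lambda>\<xi>. 0 * g \<xi>)"
      using vanishes_L2[OF that] by (rule L2_cmult)
    show "is_fourier 1 (\<lambda>\<xi>. 0 * g \<xi>) (\<lambda>x. 0 * fourier_L2 1 g x)"
      using that by (intro is_fourier_cmult vanishes_is_fourier[where v = v and c = c] L2_measurable vanishes_L2[where v = v and c = c])
  qed auto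
qed auto

lemma shift_multiplier_add:
  assumes "shift_multiplier v d k" "shift_multiplier v d l"
  shows "shift_multiplier v d (\<lambda>\<xi>. k \<xi> + l \<xi>)"
  unfolding shift_multiplier_def
proof (intro conjI allI impI)
  show "(\<lambda>\<xi>. k \<xi> + l \<xi>) \<in> borel_measurable borel"
    using assms by (auto simp: shift_multiplier_def)
  obtain A B where "\<And>\<xi>. cmod (k \<xi>) \<le> A" "\<And>\<xi>. cmod (l \<xi>) \<le> B"
    using assms by (auto simp: shift_multiplier_def)
  then show "\<exists>B. \<forall>\<xi>. cmod (k \<xi> + l \<xi>) \<le> B"
    by (meson add_mono norm_triangle_ineq order_trans)
  show "vanishes v (c + d) (\<lambda>\<xi>. (k \<xi> + l \<xi>) * g \<xi>)" if "vanishes v c g" for c g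
    using vanishes_add[of v "c + d" "\<lambda>\<xi>. k \<xi> * g \<xi>" "\<lambda>\<xi>. l \<xi> * g \<xi>"] assms that
    by (simp add: shift_multiplier_def distrib_right)
qed

lemma shift_multiplier_sum:
  assumes "finite I" "\<And>i. i \<in> I \<Longrightarrow> shift_multiplier v d (k i)"
  shows "shift_multiplier v d (\<lambda>\<xi>. \<Sum>i\<in>I. k i \<xi>)"
  using assms
  by (induction I rule: finite_induct) (auto intro: shift_multiplier_zero shift_multiplier_add)

lemma shift_multiplier_mult:
  assumes "shift_multiplier v d k" "shift_multiplier v e l"
  shows "shift_multiplier v (d + e) (\<lambda>\<xi>. k \<xi> * l \<xi>)"
  unfolding shift_multiplier_def
proof (intro conjI allI impI)
  show "(\<lambda>\<xi>. k \<xi> * l \<xi>) \<in> borel_measurable borel"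
    using assms by (auto simp: shift_multiplier_def)
  obtain A B where "\<And>\<xi>. cmod (k \<xi>) \<le> A" "\<And>\<xi>. cmod (l \<xi>) \<le> B"
    using assms by (auto simp: shift_multiplier_def)
  then have "cmod (k \<xi> * l \<xi>) \<le> A * B" for \<xi>
    unfolding norm_mult by (intro mult_mono) (auto intro: order_trans[OF norm_ge_zero])
  then show "\<exists>B. \<forall>\<xi>. cmod (k \<xi> * l \<xi>) \<le> B"
    by blast
  show "vanishes v (c + (d + e)) (\<lambda>\<xi>. k \<xi> * l \<xi> * g \<xi>)" if "vanishes v c g" for c g
  proof -
    have "vanishes v (c + e) (\<lambda>\<xi>. l \<xi> * g \<xi>)"
      using assms(2) that by (auto simp: shift_multiplier_def)
    then have "vanishes v (c + e + d) (\<lambda>\<xi>. k \<xi> * (l \<xi> * g \<xi>))"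
      using assms(1) by (auto simp: shift_multiplier_def)
    then show ?thesis
      by (simp add: algebra_simps)
  qed
qed

lemma shift_multiplier_prod:
  assumes "finite I" "\<And>i. i \<in> I \<Longrightarrow> shift_multiplier v 0 (k i)"
  shows "shift_multiplier v 0 (\<lambda>\<xi>. \<Prod>i\<in>I. k i \<xi>)"
  using assms
proof (induction I rule: finite_induct)
  case empty
  show ?case
    using shift_multiplier_cis[of v 0 0] by simp
next
  case (insert i I)
  then show ?case
    using shift_multiplier_mult[of v 0 "k i" 0 "\<lambda>\<xi>. \<Prod>i\<in>I. k i \<xi>"] by simp
qed

lemma shift_multiplier_limit:
  fixes k :: "nat \<Rightarrow> real^'n \<Rightarrow> complex"
  assumes k: "\<And>n. shift_multiplier v d (k n)" and bound: "\<And>n \<xi>. cmod (k n \<xi>) \<le> B"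
    and lim: "\<And>\<xi>. (\<lambda>n. k n \<xi>) \<longlonglongrightarrow> l \<xi>"
  shows "shift_multiplier v d l"
proof -
  have [measurable]: "k n \<in> borel_measurable borel" for n
    using k by (auto simp: shift_multiplier_def)
  have l [measurable]: "l \<in> borel_measurable borel"
    using lim by (rule borel_measurable_LIMSEQ_metric[rotated]) measurable
  have lB: "cmod (l \<xi>) \<le> B" for \<xi>
    by (rule tendsto_upperbound[OF tendsto_norm[OF lim]]) (auto simp: bound)
  show ?thesis
    unfolding shift_multiplier_def
  proof (intro conjI allI impI)
    show "\<exists>B. \<forall>\<xi>. cmod (l \<xi>) \<le> B"
      using lB by blast
    show "vanishes v (c + d) (\<lambda>\<xi>. l \<xi> * g \<xi>)" if g: "vanishes v c g" for c g
    proof (rule vanishes_limit)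
      show "vanishes v (c + d) (\<lambda>\<xi>. k n \<xi> * g \<xi>)" for n
        using k g by (auto simp: shift_multiplier_def)
      show "L2 (\<lambda>\<xi>. l \<xi> * g \<xi>)"
        by (rule L2_cmult_bound[OF vanishes_L2[OF g] l lB])
      have "(\<lambda>n. nsq (\<lambda>\<xi>. (k n \<xi> - l \<xi>) * g \<xi>)) \<longlonglongrightarrow> 0"
      proof (rule nsq_dominated_tendsto_0[OF vanishes_L2[OF g], where B = "B + B"])
        show "cmod (k n \<xi> - l \<xi>) \<le> B + B" for n \<xi>
          using norm_triangle_ineq4[of "k n \<xi>" "l \<xi>"] bound[of n \<xi>] lB[of \<xi>] by linarith
        show "(\<lambda>n. k n \<xi> - l \<xi>) \<longlonglongrightarrow> 0" for \<xi>
          using tendsto_diff[OF lim[of \<xi>] tendsto_const[of "l \<xi>"]] by simp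
      qed measurable
      then show "(\<lambda>n. nsq (\<lambda>\<xi>. k n \<xi> * g \<xi> - l \<xi> * g \<xi>)) \<longlonglongrightarrow> 0"
        by (simp only: left_diff_distrib)
    qed
  qed (fact l)
qed

section \<open>Fresnel integrals\<close>

definition cexp_primitive :: "complex \<Rightarrow> complex" where
  "cexp_primitive = (SOME E. (\<forall>z. (E has_field_derivative exp (\<i> * z\<^sup>2 / 2)) (at z)) \<and> E 0 = 0)"

lemma cexp_primitive_exists:
  "\<exists>E. (\<forall>z. (E has_field_derivative exp (\<i> * z\<^sup>2 / 2)) (at z)) \<and> E 0 = 0"
proof -
  have "(\<lambda>z. exp (\<i> * z\<^sup>2 / 2)) holomorphic_on UNIV"
    by (intro holomorphic_intros) auto
  then obtain g where g: "\<And>z. (g has_field_derivative exp (\<i> * z\<^sup>2 / 2)) (at z)"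
    using holomorphic_convex_primitive'[of UNIV "\<lambda>z. exp (\<i> * z\<^sup>2 / 2)"] by auto
  have "((\<lambda>z. g z - g 0) has_field_derivative exp (\<i> * z\<^sup>2 / 2)) (at z)" for z
    by (auto intro!: derivative_eq_intros g)
  then show ?thesis
    by (intro exI[of _ "\<lambda>z. g z - g 0"]) auto
qed

lemma cexp_primitive_DERIV: "(cexp_primitive has_field_derivative exp (\<i> * z\<^sup>2 / 2)) (at z)"
  and cexp_primitive_0 [simp]: "cexp_primitive 0 = 0"
  using someI_ex[OF cexp_primitive_exists] unfolding cexp_primitive_def by blast+

lemmas cexp_primitive_DERIV' [derivative_intros] = DERIV_chain2[OF cexp_primitive_DERIV]

abbreviation E_real :: "real \<Rightarrow> complex" where
  "E_real x \<equiv> cexp_primitive (complex_of_real x)"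

lemma exp_i_square_eq_cis: "exp (\<i> * (complex_of_real x)\<^sup>2 / 2) = cis (x\<^sup>2 / 2)"
  by (simp add: cis_conv_exp)

lemma E_real_has_vector_derivative:
  "(E_real has_vector_derivative cis (x\<^sup>2 / 2)) (at x within A)"
  using has_vector_derivative_real_field[OF cexp_primitive_DERIV[of "complex_of_real x"], of A]
  by (simp only: exp_i_square_eq_cis)

lemma E_real_affine_has_vector_derivative:
  "((\<lambda>t. E_real (r * t - q)) has_vector_derivative complex_of_real r * cis ((r * t - q)\<^sup>2 / 2)) (at t within A)"
proof -
  have "((\<lambda>t. r * t - q) has_vector_derivative r) (at t within A)"
    by (auto intro!: derivative_eq_intros simp flip: has_real_derivative_iff_has_vector_derivative)
  from vector_diff_chain_within[OF this, of E_real "cis ((r * t - q)\<^sup>2 / 2)"] E_real_has_vector_derivative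
  show ?thesis
    by (simp add: o_def scaleR_conv_of_real)
qed

lemma fresnel_eq_E_real:
  "complex_of_real (fresnelC x) + \<i> * complex_of_real (fresnelS x) = E_real (sqrt pi * x) / complex_of_real (sqrt pi)"
proof -
  let ?F = "\<lambda>t. E_real (sqrt pi * t) / complex_of_real (sqrt pi)"
  have F: "(?F has_vector_derivative cis (pi / 2 * t\<^sup>2)) (at t within A)" for t A
  proof -
    have "(?F has_vector_derivative (complex_of_real (sqrt pi) * cis ((sqrt pi * t - 0)\<^sup>2 / 2)) / complex_of_real (sqrt pi)) (at t within A)"
      by (intro has_vector_derivative_divide) (use E_real_affine_has_vector_derivative[of "sqrt pi" 0 t A] in simp)
    then show ?thesis
      by (simp add: power_mult_distrib)
  qed
  have "fresnelC x = (LBINT t=ereal 0..ereal x. cos (pi / 2 * t\<^sup>2))"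
    by (simp add: fresnelC_def zero_ereal_def)
  also have "\<dots> = Re (?F x) - Re (?F 0)"
  proof (rule interval_integral_FTC_finite)
    show "((\<lambda>t. Re (?F t)) has_vector_derivative cos (pi / 2 * t\<^sup>2)) (at t within {min 0 x..max 0 x})" for t
      using bounded_linear.has_vector_derivative[OF bounded_linear_Re F[of t]] by (simp only: cis.sel)
  qed (auto intro!: continuous_intros)
  finally have C: "fresnelC x = Re (?F x)"
    by simp
  have "fresnelS x = (LBINT t=ereal 0..ereal x. sin (pi / 2 * t\<^sup>2))"
    by (simp add: fresnelS_def zero_ereal_def)
  also have "\<dots> = Im (?F x) - Im (?F 0)"
  proof (rule interval_integral_FTC_finite)
    show "((\<lambda>t. Im (?F t)) has_vector_derivative sin (pi / 2 * t\<^sup>2)) (at t within {min 0 x..max 0 x})" for t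
      using bounded_linear.has_vector_derivative[OF bounded_linear_Im F[of t]] by (simp only: cis.sel)
  qed (auto intro!: continuous_intros)
  finally have S: "fresnelS x = Im (?F x)"
    by simp
  show ?thesis
    unfolding C S by (rule complex_eq[symmetric])
qed

definition E_lim :: complex where
  "E_lim = (1 + \<i>) * complex_of_real (sqrt pi / 2)"

lemma one_minus_theta_tilde:
  "1 - theta_tilde y = (1 - \<i>) / complex_of_real (2 * sqrt pi) * (E_real (- y) + E_lim)"
proof -
  have "theta_tilde y = 1 / 2 - (1 - \<i>) / 2 * (E_real (- y) / complex_of_real (sqrt pi))"
    unfolding theta_tilde_def fresnel_eq_E_real by simp
  moreover have "(1 - \<i>) / complex_of_real (2 * sqrt pi) * E_lim = 1 / 2"
    by (simp add: E_lim_def field_simps)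
  ultimately show ?thesis
    by (simp add: distrib_left)
qed

lemma cexp_primitive_minus: "cexp_primitive (- z) = - cexp_primitive z"
proof -
  have "((\<lambda>z. cexp_primitive z + cexp_primitive (- z)) has_field_derivative 0) (at z)" for z
    by (auto intro!: derivative_eq_intros)
  then obtain c where "\<And>z. cexp_primitive z + cexp_primitive (- z) = c"
    using has_field_derivative_zero_constant[of UNIV "\<lambda>z. cexp_primitive z + cexp_primitive (- z)"] by auto
  from this[of 0] this[of z] show ?thesis
    by (simp add: eq_neg_iff_add_eq_0 add.commute)
qed

text \<open>On the diagonal the integrand becomes a real Gaussian, and the vertical segment joining
  the diagonal to the real axis contributes only O(1/x).\<close>

lemma cexp_primitive_diagonal_tendsto:
  "((\<lambda>x. cexp_primitive ((1 + \<i>) * complex_of_real x)) \<longlongrightarrow> E_lim) at_top"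
proof -
  let ?F = "\<lambda>x. cexp_primitive ((1 + \<i>) * complex_of_real x) / (1 + \<i>)"
  have nz: "1 + \<i> \<noteq> 0"
    by (simp add: complex_eq_iff)
  have sq: "\<i> * ((1 + \<i>) * complex_of_real x)\<^sup>2 / 2 = complex_of_real (- x\<^sup>2)" for x
    by (simp add: power2_eq_square algebra_simps)
  have "((\<lambda>z. cexp_primitive ((1 + \<i>) * z) / (1 + \<i>)) has_field_derivative exp (\<i> * ((1 + \<i>) * z)\<^sup>2 / 2)) (at z)" for z
    using nz by (auto intro!: derivative_eq_intros)
  from has_vector_derivative_real_field[OF this]
  have F: "(?F has_vector_derivative complex_of_real (exp (- x\<^sup>2))) (at x within A)" for x A
    by (simp only: sq exp_of_real)
  have "((\<lambda>y. LINT x|lborel. indicator {..y} x *\<^sub>R (indicator {0..} x *\<^sub>R exp (- x\<^sup>2))) \<longlongrightarrow> sqrt pi / 2) at_top"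
    using tendsto_integral_at_top[of lborel "\<lambda>x. indicator {0..} x *\<^sub>R exp (- x\<^sup>2) :: real"]
      has_bochner_integral_integral_eq[OF gaussian_moment_0]
      integrable.intros[OF gaussian_moment_0]
    by (simp only: sets_lborel)
  then have "((\<lambda>y. complex_of_real (LINT x|lborel. indicator {..y} x *\<^sub>R (indicator {0..} x *\<^sub>R exp (- x\<^sup>2))))
      \<longlongrightarrow> complex_of_real (sqrt pi / 2)) at_top"
    by (rule tendsto_of_real)
  then have "(?F \<longlongrightarrow> complex_of_real (sqrt pi / 2)) at_top"
  proof (rule Lim_transform_eventually)
    show "\<forall>\<^sub>F y in at_top. complex_of_real (LINT x|lborel. indicator {..y} x *\<^sub>R (indicator {0..} x *\<^sub>R exp (- x\<^sup>2))) = ?F y"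
      using eventually_ge_at_top[of 0]
    proof eventually_elim
      case (elim y)
      have "complex_of_real (LINT x|lborel. indicator {..y} x *\<^sub>R (indicator {0..} x *\<^sub>R exp (- x\<^sup>2)))
          = (LINT x|lborel. complex_of_real (indicator {..y} x *\<^sub>R (indicator {0..} x *\<^sub>R exp (- x\<^sup>2))))"
        by (rule integral_complex_of_real[symmetric])
      also have "\<dots> = (LINT x|lborel. indicator {0..y} x *\<^sub>R complex_of_real (exp (- x\<^sup>2)))"
        by (intro Bochner_Integration.integral_cong refl) (auto split: split_indicator)
      also have "\<dots> = ?F y - ?F 0"
        by (rule integral_FTC_Icc[OF elim F]) (auto intro!: continuous_intros)
      finally show ?case
        by simp
    qed
  qed
  then have "((\<lambda>x. (1 + \<i>) * ?F x) \<longlongrightarrow> (1 + \<i>) * complex_of_real (sqrt pi / 2)) at_top"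
    by (intro tendsto_mult tendsto_const)
  then show ?thesis
    using nz by (simp add: E_lim_def)
qed

lemma cexp_primitive_vertical_bound:
  assumes "x > 0"
  shows "cmod (cexp_primitive ((1 + \<i>) * complex_of_real x) - E_real x) \<le> 1 / x"
proof -
  let ?f = "\<lambda>s. cexp_primitive (complex_of_real x + \<i> * complex_of_real s)"
  let ?f' = "\<lambda>s. exp (\<i> * (complex_of_real x + \<i> * complex_of_real s)\<^sup>2 / 2) * \<i>"
  let ?p = "\<lambda>s. - exp (- x * s) / x"
  have "((\<lambda>z. cexp_primitive (complex_of_real x + \<i> * z)) has_field_derivative exp (\<i> * (complex_of_real x + \<i> * z)\<^sup>2 / 2) * \<i>) (at z)" for z
    by (auto intro!: derivative_eq_intros)
  from has_vector_derivative_real_field[OF this]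
  have f: "(?f has_vector_derivative ?f' s) (at s within A)" for s A .
  have p: "(?p has_vector_derivative exp (- x * s)) (at s within A)" for s A
    unfolding has_real_derivative_iff_has_vector_derivative[symmetric]
    using assms by (auto intro!: derivative_eq_intros)
  have "norm (?f x - ?f 0) \<le> ?p x - ?p 0"
  proof (rule differentiable_bound_general[OF assms])
    show "continuous_on {0..x} ?f" "continuous_on {0..x} ?p"
      using f p by (auto intro!: continuous_on_vector_derivative)
    show "(?f has_vector_derivative ?f' s) (at s)" "(?p has_vector_derivative exp (- x * s)) (at s)" for s
      by (fact f, fact p)
    show "norm (?f' s) \<le> exp (- x * s)" for s
      by (simp add: norm_mult power2_eq_square algebra_simps)
  qed
  also have "\<dots> \<le> 1 / x"
    using assms by (simp add: field_simps)
  finally show ?thesis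
    by (simp add: algebra_simps)
qed

lemma E_real_tendsto_at_top: "(E_real \<longlongrightarrow> E_lim) at_top"
proof -
  let ?D = "\<lambda>x. cexp_primitive ((1 + \<i>) * complex_of_real x)"
  have "((\<lambda>x. ?D x - E_real x) \<longlongrightarrow> 0) at_top"
  proof (rule Lim_null_comparison)
    show "\<forall>\<^sub>F x in at_top. norm (?D x - E_real x) \<le> 1 / x"
      using eventually_gt_at_top[of 0] by eventually_elim (rule cexp_primitive_vertical_bound)
    show "((\<lambda>x::real. 1 / x) \<longlongrightarrow> 0) at_top"
      by real_asymp
  qed
  from tendsto_diff[OF cexp_primitive_diagonal_tendsto this] show ?thesis
    by simp
qed

lemma E_real_tendsto_at_bot: "(E_real \<longlongrightarrow> - E_lim) at_bot"
proof -
  have "((\<lambda>x. - E_real (- x)) \<longlongrightarrow> - E_lim) at_bot"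
    by (intro tendsto_minus filterlim_compose[OF E_real_tendsto_at_top] filterlim_uminus_at_top_at_bot)
  then show ?thesis
    by (simp add: cexp_primitive_minus)
qed

lemma continuous_E_real: "continuous_on A E_real"
  by (rule continuous_on_vector_derivative) (rule E_real_has_vector_derivative)

lemma E_real_bounded: "\<exists>M. \<forall>x. cmod (E_real x) \<le> M"
proof -
  have "\<forall>\<^sub>F x in at_top. dist (E_real x) E_lim < 1"
    by (rule tendstoD[OF E_real_tendsto_at_top]) simp
  then obtain N where N: "\<And>x. x \<ge> N \<Longrightarrow> dist (E_real x) E_lim < 1"
    by (auto simp: eventually_at_top_linorder)
  have "compact (E_real ` {0..N})"
    by (intro compact_continuous_image continuous_E_real) simp
  then obtain B where B: "\<And>x. x \<in> {0..N} \<Longrightarrow> cmod (E_real x) \<le> B"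
    using compact_imp_bounded[of "E_real ` {0..N}"] by (force simp: bounded_iff)
  have pos: "cmod (E_real x) \<le> max B (cmod E_lim + 1)" if "x \<ge> 0" for x
  proof (cases "x \<le> N")
    case True
    with that B[of x] show ?thesis by auto
  next
    case False
    then have "dist (E_real x) E_lim < 1"
      by (intro N) auto
    then have "cmod (E_real x) \<le> cmod E_lim + 1"
      using norm_triangle_sub[of "E_real x" E_lim] by (simp add: dist_norm)
    then show ?thesis by simp
  qed
  have "cmod (E_real x) \<le> max B (cmod E_lim + 1)" for x
    using pos[of x] pos[of "- x"] by (cases "x \<ge> 0") (auto simp: cexp_primitive_minus)
  then show ?thesis
    by blast
qed

lemma riemann_sum_tendsto:
  fixes f f' :: "real \<Rightarrow> complex"
  assumes ab: "a \<le> b" and f: "\<And>t. t \<in> {a..b} \<Longrightarrow> (f has_vector_derivative f' t) (at t within {a..b})"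
    and cont: "continuous_on {a..b} f'"
  shows "(\<lambda>n. \<Sum>i<Suc n. complex_of_real ((b - a) / real (Suc n)) * f' (a + real i * ((b - a) / real (Suc n)))) \<longlonglongrightarrow> f b - f a"
proof (rule LIMSEQ_I)
  fix e :: real assume "e > 0"
  define e' where "e' = e / (b - a + 1)"
  have e': "e' > 0" "(b - a) * e' < e"
    using \<open>e > 0\<close> ab by (auto simp: e'_def field_simps)
  have "uniformly_continuous_on {a..b} f'"
    using cont by (rule compact_uniformly_continuous) simp
  then obtain d where d: "d > 0" "\<And>s t. s \<in> {a..b} \<Longrightarrow> t \<in> {a..b} \<Longrightarrow> dist t s < d \<Longrightarrow> dist (f' t) (f' s) < e'"
    using e'(1) unfolding uniformly_continuous_on_def by metis
  obtain n0 where n0: "(b - a) / d < real n0"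
    using reals_Archimedean2 by blast
  show "\<exists>no. \<forall>n\<ge>no. norm ((\<Sum>i<Suc n. complex_of_real ((b - a) / real (Suc n)) * f' (a + real i * ((b - a) / real (Suc n)))) - (f b - f a)) < e"
  proof (intro exI[of _ n0] allI impI)
    fix n assume "n \<ge> n0"
    define h where "h = (b - a) / real (Suc n)"
    define p where "p = (\<lambda>i. a + real i * h)"
    have h: "h \<ge> 0" "h < d" "real (Suc n) * h = b - a"
    proof -
      show "h \<ge> 0" "real (Suc n) * h = b - a"
        using ab by (auto simp: h_def)
      have "b - a < real n0 * d"
        using n0 d(1) by (simp add: field_simps)
      also have "\<dots> \<le> real (Suc n) * d"
        using \<open>n \<ge> n0\<close> d(1) by (intro mult_right_mono) auto
      finally show "h < d"
        by (simp add: h_def field_simps)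
    qed
    have p_in: "p i \<in> {a..b}" if "i \<le> Suc n" for i
    proof -
      have "real i * h \<le> real (Suc n) * h"
        using that h by (intro mult_right_mono) auto
      then show ?thesis
        using h by (auto simp: p_def)
    qed
    have step: "norm (f (p (Suc i)) - f (p i) - complex_of_real h * f' (p i)) \<le> h * e'" if "i < Suc n" for i
    proof -
      have le: "p i \<le> p (Suc i)" and hh: "p (Suc i) - p i = h"
        using h by (auto simp: p_def algebra_simps)
      have sub: "{p i..p (Suc i)} \<subseteq> {a..b}"
        using p_in[of i] p_in[of "Suc i"] that by auto
      have "norm (f (p (Suc i)) - f (p i) - (p (Suc i) - p i) *\<^sub>R f' (p i)) \<le> norm (p (Suc i) - p i) * e'"
      proof (rule vector_differentiable_bound_linearization[where S = "{p i..p (Suc i)}" and f' = f'])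
        show "(f has_vector_derivative f' t) (at t within {p i..p (Suc i)})" if "t \<in> {p i..p (Suc i)}" for t
          using f[of t] that sub by (auto intro: has_vector_derivative_within_subset)
        show "closed_segment (p i) (p (Suc i)) \<subseteq> {p i..p (Suc i)}"
          using le by (simp add: closed_segment_eq_real_ivl)
        show "norm (f' t - f' (p i)) \<le> e'" if "t \<in> {p i..p (Suc i)}" for t
        proof -
          have "dist t (p i) < d"
            using that hh h by (auto simp: dist_real_def)
          then show ?thesis
            using d(2)[of "p i" t] that sub le by (auto simp: dist_norm intro: less_imp_le)
        qed
      qed (use le in auto)
      then show ?thesis
        using h by (simp add: hh scaleR_conv_of_real)
    qed
    have "p (Suc n) = b" "p 0 = a"
      using h(3) by (simp_all add: p_def del: of_nat_Suc)
    then have "f b - f a = (\<Sum>i<Suc n. f (p (Suc i)) - f (p i))"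
      using sum_lessThan_telescope[of "\<lambda>i. f (p i)" "Suc n"] by (simp only:)
    then have "(\<Sum>i<Suc n. complex_of_real h * f' (p i)) - (f b - f a)
        = (\<Sum>i<Suc n. complex_of_real h * f' (p i) - (f (p (Suc i)) - f (p i)))"
      by (simp only: sum_subtractf)
    also have "norm \<dots> \<le> (\<Sum>i<Suc n. h * e')"
      by (intro sum_norm_le) (use step in \<open>auto simp: norm_minus_commute\<close>)
    also have "\<dots> = (b - a) * e'"
      using h(3) by (simp add: mult.assoc[symmetric])
    also have "\<dots> < e"
      by (rule e')
    finally show "norm ((\<Sum>i<Suc n. complex_of_real ((b - a) / real (Suc n)) * f' (a + real i * ((b - a) / real (Suc n)))) - (f b - f a)) < e"
      by (simp add: h_def p_def)
  qed
qed

section \<open>Fresnel multipliers and the leakage estimate\<close>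

definition chirp :: "real \<Rightarrow> real \<Rightarrow> complex" where
  "chirp fr t = cis (- t\<^sup>2 / (2 * fr))"

lemma shift_multiplier_fresnel_interval:
  fixes v w :: "real^'n"
  assumes fr: "fr > 0" and ab: "a \<le> b" and d: "\<And>t. t \<in> {a..b} \<Longrightarrow> v \<bullet> (t *\<^sub>R w) \<le> d"
  shows "shift_multiplier v d (\<lambda>\<xi>. chirp fr (\<xi> \<bullet> w) *
    (E_real (sqrt fr * b - (\<xi> \<bullet> w) / sqrt fr) - E_real (sqrt fr * a - (\<xi> \<bullet> w) / sqrt fr)))"
proof -
  define h where "h = (\<lambda>n. (b - a) / real (Suc n))"
  define p where "p = (\<lambda>n i. a + real i * h n)"
  define K where "K = (\<lambda>n \<xi>. \<Sum>i<Suc n. (complex_of_real (h n * sqrt fr) * cis (fr * (p n i)\<^sup>2 / 2)) * cis (- (\<xi> \<bullet> (p n i *\<^sub>R w))))"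
  have h: "h n \<ge> 0" "real (Suc n) * h n = b - a" for n
    using ab by (auto simp: h_def)
  have p_in: "p n i \<in> {a..b}" if "i < Suc n" for n i
  proof -
    have "real i * h n \<le> real (Suc n) * h n"
      using that h by (intro mult_right_mono) auto
    then show ?thesis
      using h[of n] by (auto simp: p_def)
  qed
  show ?thesis
  proof (rule shift_multiplier_limit)
    show "shift_multiplier v d (K n)" for n
      unfolding K_def
      by (intro shift_multiplier_sum shift_multiplier_cmult shift_multiplier_cis d p_in) auto
    show "cmod (K n \<xi>) \<le> (b - a) * sqrt fr" for n \<xi>
    proof -
      have "cmod (K n \<xi>) \<le> (\<Sum>i<Suc n. h n * sqrt fr)"
        unfolding K_def by (intro sum_norm_le) (use h[of n] fr in \<open>auto simp: norm_mult\<close>)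
      also have "\<dots> = (real (Suc n) * h n) * sqrt fr"
        by simp
      finally show ?thesis
        by (simp only: h)
    qed
    show "(\<lambda>n. K n \<xi>) \<longlonglongrightarrow> chirp fr (\<xi> \<bullet> w) *
      (E_real (sqrt fr * b - (\<xi> \<bullet> w) / sqrt fr) - E_real (sqrt fr * a - (\<xi> \<bullet> w) / sqrt fr))" for \<xi>
    proof -
      let ?e = "\<xi> \<bullet> w"
      let ?f = "\<lambda>t. chirp fr ?e * E_real (sqrt fr * t - ?e / sqrt fr)"
      let ?f' = "\<lambda>t. complex_of_real (sqrt fr) * cis (fr * t\<^sup>2 / 2) * cis (- (\<xi> \<bullet> (t *\<^sub>R w)))"
      have f: "(?f has_vector_derivative ?f' t) (at t within A)" for t A
      proof -
        have "- ?e\<^sup>2 / (2 * fr) + (sqrt fr * t - ?e / sqrt fr)\<^sup>2 / 2 = fr * t\<^sup>2 / 2 - t * ?e"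
          using fr by (simp add: power2_diff power_mult_distrib power_divide field_simps power2_eq_square)
        then have "chirp fr ?e * (complex_of_real (sqrt fr) * cis ((sqrt fr * t - ?e / sqrt fr)\<^sup>2 / 2)) = ?f' t"
          by (simp add: chirp_def cis_mult mult.left_commute[of _ "complex_of_real (sqrt fr)"])
        moreover have "(?f has_vector_derivative chirp fr ?e * (complex_of_real (sqrt fr) * cis ((sqrt fr * t - ?e / sqrt fr)\<^sup>2 / 2))) (at t within A)"
          by (intro has_vector_derivative_mult_right E_real_affine_has_vector_derivative)
        ultimately show ?thesis
          by (simp only:)
      qed
      have "(\<lambda>n. \<Sum>i<Suc n. complex_of_real ((b - a) / real (Suc n)) * ?f' (a + real i * ((b - a) / real (Suc n)))) \<longlonglongrightarrow> ?f b - ?f a"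
        by (rule riemann_sum_tendsto[OF ab f]) (auto intro!: continuous_intros)
      moreover have "(\<Sum>i<Suc n. complex_of_real ((b - a) / real (Suc n)) * ?f' (a + real i * ((b - a) / real (Suc n)))) = K n \<xi>" for n
        unfolding K_def p_def h_def by (intro sum.cong refl) (simp add: mult.assoc)
      ultimately show ?thesis
        by (simp only: right_diff_distrib)
    qed
  qed
qed

lemma shift_multiplier_fresnel_halfline:
  fixes v w :: "real^'n"
  assumes fr: "fr > 0" and d: "\<And>t. t \<le> b \<Longrightarrow> v \<bullet> (t *\<^sub>R w) \<le> d"
  shows "shift_multiplier v d (\<lambda>\<xi>. chirp fr (\<xi> \<bullet> w) * (E_real (sqrt fr * b - (\<xi> \<bullet> w) / sqrt fr) + E_lim))"
proof -
  obtain M where M: "\<And>x. cmod (E_real x) \<le> M"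
    using E_real_bounded by blast
  show ?thesis
  proof (rule shift_multiplier_limit)
    show "shift_multiplier v d (\<lambda>\<xi>. chirp fr (\<xi> \<bullet> w) *
      (E_real (sqrt fr * b - (\<xi> \<bullet> w) / sqrt fr) - E_real (sqrt fr * (b - real n) - (\<xi> \<bullet> w) / sqrt fr)))" for n
      by (rule shift_multiplier_fresnel_interval[OF fr _ d]) simp_all
    show "cmod (chirp fr (\<xi> \<bullet> w) *
      (E_real (sqrt fr * b - (\<xi> \<bullet> w) / sqrt fr) - E_real (sqrt fr * (b - real n) - (\<xi> \<bullet> w) / sqrt fr))) \<le> M + M" for n \<xi>
      using norm_triangle_ineq4[of "E_real (sqrt fr * b - (\<xi> \<bullet> w) / sqrt fr)" "E_real (sqrt fr * (b - real n) - (\<xi> \<bullet> w) / sqrt fr)"]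
        M[of "sqrt fr * b - (\<xi> \<bullet> w) / sqrt fr"] M[of "sqrt fr * (b - real n) - (\<xi> \<bullet> w) / sqrt fr"]
      by (simp add: norm_mult chirp_def del: of_real_diff of_real_mult of_real_divide)
    show "(\<lambda>n. chirp fr (\<xi> \<bullet> w) *
      (E_real (sqrt fr * b - (\<xi> \<bullet> w) / sqrt fr) - E_real (sqrt fr * (b - real n) - (\<xi> \<bullet> w) / sqrt fr)))
      \<longlonglongrightarrow> chirp fr (\<xi> \<bullet> w) * (E_real (sqrt fr * b - (\<xi> \<bullet> w) / sqrt fr) + E_lim)" for \<xi>
    proof -
      define r where "r = sqrt fr"
      define q where "q = (\<xi> \<bullet> w) / sqrt fr"
      have "r > 0" using fr by (simp add: r_def)
      then have "filterlim (\<lambda>n. r * (b - real n) - q) at_bot sequentially"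
        by real_asymp
      then have "(\<lambda>n. E_real (r * (b - real n) - q)) \<longlonglongrightarrow> - E_lim"
        by (rule filterlim_compose[OF E_real_tendsto_at_bot])
      then have "(\<lambda>n. chirp fr (\<xi> \<bullet> w) * (E_real (r * b - q) - E_real (r * (b - real n) - q)))
          \<longlonglongrightarrow> chirp fr (\<xi> \<bullet> w) * (E_real (r * b - q) - - E_lim)"
        by (intro tendsto_intros)
      then show ?thesis
        by (simp only: r_def q_def diff_minus_eq_add)
    qed
  qed
qed

lemma shift_multiplier_theta_tilde:
  fixes v :: "real^'n"
  assumes fr: "fr > 0" and v: "norm v = 1" and D: "D > 0"
  shows "shift_multiplier v D (\<lambda>\<xi>. chirp fr (\<xi> \<bullet> v) * (1 - theta_tilde ((\<xi> \<bullet> v) / sqrt fr - sqrt (D\<^sup>2 * fr))))"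
proof -
  have "v \<bullet> v = 1"
    using v by (simp add: dot_square_norm)
  then have "shift_multiplier v D (\<lambda>\<xi>. (1 - \<i>) / complex_of_real (2 * sqrt pi) *
      (chirp fr (\<xi> \<bullet> v) * (E_real (sqrt fr * D - (\<xi> \<bullet> v) / sqrt fr) + E_lim)))"
    by (intro shift_multiplier_cmult shift_multiplier_fresnel_halfline fr) simp
  moreover have "sqrt (D\<^sup>2 * fr) = sqrt fr * D"
    using D by (simp add: real_sqrt_mult)
  ultimately show ?thesis
    unfolding one_minus_theta_tilde by (simp add: mult.left_commute)
qed

lemma shift_multiplier_chirp:
  fixes v w :: "real^'n"
  assumes fr: "fr > 0" and vw: "v \<bullet> w = 0"
  shows "shift_multiplier v 0 (\<lambda>\<xi>. chirp fr (\<xi> \<bullet> w))"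
proof -
  obtain M where M: "\<And>x. cmod (E_real x) \<le> M"
    using E_real_bounded by blast
  have "E_lim \<noteq> 0"
    by (simp add: E_lim_def complex_eq_iff)
  have "shift_multiplier v 0 (\<lambda>\<xi>. chirp fr (\<xi> \<bullet> w) * (E_lim + E_lim))"
  proof (rule shift_multiplier_limit)
    show "shift_multiplier v 0 (\<lambda>\<xi>. chirp fr (\<xi> \<bullet> w) * (E_real (sqrt fr * real n - (\<xi> \<bullet> w) / sqrt fr) + E_lim))" for n
      by (rule shift_multiplier_fresnel_halfline[OF fr]) (simp add: vw)
    show "cmod (chirp fr (\<xi> \<bullet> w) * (E_real (sqrt fr * real n - (\<xi> \<bullet> w) / sqrt fr) + E_lim)) \<le> M + cmod E_lim" for n \<xi>
      using norm_triangle_ineq[of "E_real (sqrt fr * real n - (\<xi> \<bullet> w) / sqrt fr)" E_lim] M[of "sqrt fr * real n - (\<xi> \<bullet> w) / sqrt fr"]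
      by (simp add: norm_mult chirp_def del: of_real_diff of_real_mult of_real_divide)
    show "(\<lambda>n. chirp fr (\<xi> \<bullet> w) * (E_real (sqrt fr * real n - (\<xi> \<bullet> w) / sqrt fr) + E_lim))
        \<longlonglongrightarrow> chirp fr (\<xi> \<bullet> w) * (E_lim + E_lim)" for \<xi>
    proof -
      define r where "r = sqrt fr"
      define q where "q = (\<xi> \<bullet> w) / sqrt fr"
      have "r > 0" using fr by (simp add: r_def)
      then have "filterlim (\<lambda>n. r * real n - q) at_top sequentially"
        by real_asymp
      then have "(\<lambda>n. E_real (r * real n - q)) \<longlonglongrightarrow> E_lim"
        by (rule filterlim_compose[OF E_real_tendsto_at_top])
      then show ?thesis
        unfolding r_def q_def by (intro tendsto_intros)
    qed
  qed
  from shift_multiplier_cmult[OF this, of "1 / (E_lim + E_lim)"] show ?thesis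
    using \<open>E_lim \<noteq> 0\<close> by (simp add: mult_2[symmetric])
qed

lemma mult_f_eq_prod_chirp: "mult_f fr \<xi> = (\<Prod>l\<in>UNIV. chirp fr (\<xi> $ l))"
proof -
  have "- (norm \<xi>)\<^sup>2 / (2 * fr) = (\<Sum>l\<in>UNIV. - (\<xi> $ l)\<^sup>2 / (2 * fr))"
    by (simp add: norm_vec_def L2_set_def sum_nonneg sum_divide_distrib sum_negf)
  then show ?thesis
    unfolding mult_f_def chirp_def by (simp only: cis_sum finite_class.finite_UNIV)
qed

lemma shift_multiplier_mult_f_theta_tilde:
  fixes v :: "real^'n"
  assumes fr: "fr > 0" and s: "\<bar>s\<bar> = 1" and D: "D > 0" and v: "v = axis j s"
  shows "shift_multiplier v D (\<lambda>\<xi>. mult_f fr \<xi> * (1 - theta_tilde (s * \<xi> $ j / sqrt fr - sqrt (D\<^sup>2 * fr))))"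
proof -
  have "shift_multiplier v 0 (\<lambda>\<xi>. \<Prod>l\<in>UNIV - {j}. chirp fr (\<xi> \<bullet> axis l 1))"
    by (intro shift_multiplier_prod shift_multiplier_chirp fr) (auto simp: v inner_axis_axis)
  moreover have "norm v = 1"
    using s by (simp add: v norm_eq_sqrt_inner inner_axis_axis)
  then have "shift_multiplier v D (\<lambda>\<xi>. chirp fr (\<xi> \<bullet> v) * (1 - theta_tilde ((\<xi> \<bullet> v) / sqrt fr - sqrt (D\<^sup>2 * fr))))"
    by (rule shift_multiplier_theta_tilde[OF fr _ D])
  ultimately have "shift_multiplier v (0 + D) (\<lambda>\<xi>. (\<Prod>l\<in>UNIV - {j}. chirp fr (\<xi> \<bullet> axis l 1)) *
      (chirp fr (\<xi> \<bullet> v) * (1 - theta_tilde ((\<xi> \<bullet> v) / sqrt fr - sqrt (D\<^sup>2 * fr)))))"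
    by (rule shift_multiplier_mult)
  moreover have "(\<Prod>l\<in>UNIV - {j}. chirp fr (\<xi> \<bullet> axis l 1)) * (chirp fr (\<xi> \<bullet> v) * c) = mult_f fr \<xi> * c" for \<xi> c
  proof -
    have "(\<xi> \<bullet> v)\<^sup>2 = (\<xi> $ j)\<^sup>2"
      using s by (auto simp: v inner_axis power_mult_distrib abs_if split: if_splits)
    then have "chirp fr (\<xi> \<bullet> v) = chirp fr (\<xi> $ j)"
      by (simp add: chirp_def)
    then show ?thesis
      by (simp add: mult_f_eq_prod_chirp inner_axis prod.remove[of UNIV j])
  qed
  moreover have "\<xi> \<bullet> v = s * \<xi> $ j" for \<xi>
    by (simp add: v inner_axis)
  ultimately show ?thesis
    by (simp only: add_0)
qed

lemma cmod_fourier_integral_le: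
  "cmod (fourier_integral s f \<xi>) \<le> (2 * pi) powr (- real CARD('n) / 2) * (LINT x|lborel. cmod (f x))"
  for f :: "real^'n \<Rightarrow> complex"
proof -
  have "cmod (LINT x|lborel. cis (s * (\<xi> \<bullet> x)) * f x) \<le> (LINT x|lborel. cmod (cis (s * (\<xi> \<bullet> x)) * f x))"
    by (rule integral_norm_bound)
  then show ?thesis
    by (simp add: fourier_integral_def norm_mult mult_left_mono)
qed

lemma vanishes_fourier_L2:
  fixes h :: "real^'n \<Rightarrow> complex"
  assumes h: "L2 h" and hi: "integrable lborel h" and supp: "\<And>x. h x \<noteq> 0 \<Longrightarrow> v \<bullet> x \<le> c" and v: "norm v = 1"
  shows "vanishes v c (fourier_L2 (-1) h)"
proof -
  define H where "H = fourier_integral (-1) h"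
  define a where "a = (\<lambda>n. 1 / real (Suc n))"
  define g where "g = (\<lambda>n \<xi>. complex_of_real (exp (- a n * (norm \<xi>)\<^sup>2 / 2)) * H \<xi>)"
  have a: "a n > 0" for n
    by (simp add: a_def)
  note [measurable] = L2_measurable[OF h]
  have Hm [measurable]: "H \<in> borel_measurable borel"
    unfolding H_def by measurable
  have gm [measurable]: "g n \<in> borel_measurable borel" for n
    unfolding g_def by measurable
  have AE_H: "AE \<xi> in lborel. fourier_L2 (-1) h \<xi> = H \<xi>"
    unfolding H_def by (rule fourier_L2_AE_eq[OF h _ is_fourier_integrable[OF h hi]]) auto
  have HL: "L2 H"
    using L2_fourier_L2[OF h, of "-1"] nsq_cong_AE[OF AE_H] Hm by (simp add: L2_def)
  have gL: "L2 (g n)" for n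
    unfolding g_def using HL by (rule L2_cmult_bound[where B = 1]) (use a[of n] in auto)
  have gi: "integrable lborel (g n)" for n
  proof -
    define B where "B = (2 * pi) powr (- real CARD('n) / 2) * (LINT x|lborel. cmod (h x))"
    have HB: "cmod (H \<xi>) \<le> B" for \<xi>
      unfolding H_def B_def by (rule cmod_fourier_integral_le)
    have "integrable lborel (\<lambda>\<xi>::real^'n. exp (- a n * (norm \<xi>)\<^sup>2 / 2) * B)"
      by (intro integrable_mult_left gaussian_integral a)
    then show ?thesis
    proof (rule Bochner_Integration.integrable_bound)
      show "AE \<xi> in lborel. norm (g n \<xi>) \<le> norm (exp (- a n * (norm \<xi>)\<^sup>2 / 2) * B)"
      proof (rule AE_I2)
        fix \<xi>
        have "cmod (H \<xi>) \<le> \<bar>B\<bar>"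
          using HB[of \<xi>] by linarith
        then show "norm (g n \<xi>) \<le> norm (exp (- a n * (norm \<xi>)\<^sup>2 / 2) * B)"
          by (simp add: g_def norm_mult abs_mult)
      qed
    qed simp
  qed
  have lim_g: "(\<lambda>n. nsq (\<lambda>\<xi>. g n \<xi> - H \<xi>)) \<longlonglongrightarrow> 0"
  proof -
    have "(\<lambda>n. nsq (\<lambda>\<xi>. complex_of_real (exp (- a n * (norm \<xi>)\<^sup>2 / 2) - 1) * H \<xi>)) \<longlonglongrightarrow> 0"
    proof (rule nsq_dominated_tendsto_0[OF HL, where B = 1])
      show "cmod (complex_of_real (exp (- a n * (norm \<xi>)\<^sup>2 / 2) - 1)) \<le> 1" for n and \<xi> :: "real^'n"
      proof -
        have "exp (- a n * (norm \<xi>)\<^sup>2 / 2) \<le> 1"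
          using a[of n] by simp
        moreover have "exp (- a n * (norm \<xi>)\<^sup>2 / 2) > 0"
          by simp
        ultimately show ?thesis
          unfolding norm_of_real by linarith
      qed
      show "(\<lambda>n. complex_of_real (exp (- a n * (norm \<xi>)\<^sup>2 / 2) - 1)) \<longlonglongrightarrow> 0" for \<xi> :: "real^'n"
      proof -
        have "a \<longlonglongrightarrow> 0"
          unfolding a_def by real_asymp
        then have "(\<lambda>n. complex_of_real (exp (- a n * (norm \<xi>)\<^sup>2 / 2) - 1)) \<longlonglongrightarrow> complex_of_real (exp (- 0 * (norm \<xi>)\<^sup>2 / 2) - 1)"
          by (intro tendsto_intros) auto
        then show ?thesis by simp
      qed
    qed measurable
    then show ?thesis
      by (simp add: g_def left_diff_distrib)
  qed
  define P where "P = (\<lambda>n. fourier_integral 1 (g n))"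
  have Pm [measurable]: "P n \<in> borel_measurable borel" for n
    unfolding P_def by measurable
  have P_lim: "(\<lambda>n. P n x) \<longlonglongrightarrow> 0" if x: "v \<bullet> x > c" for x
  proof -
    define \<delta> where "\<delta> = v \<bullet> x - c"
    define N where "N = real CARD('n) / 2"
    define I where "I = (LINT y|lborel. cmod (h y))"
    have \<delta>: "\<delta> > 0" and N: "N > 0"
      using x by (auto simp: \<delta>_def N_def)
    have bound: "cmod (P n x) \<le> (2 * pi / real (Suc n)) powr (- N) * (exp (- \<delta>\<^sup>2 * real (Suc n) / 2) * I)" for n
    proof -
      have Pn: "P n x = complex_of_real ((2 * pi * a n) powr (- N)) *
          (LINT y|lborel. complex_of_real (exp (- (norm (x - y))\<^sup>2 / (2 * a n))) * h y)"
        unfolding P_def g_def H_def N_def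
        using fourier_integral_damped_inverse[OF hi a, of n x] by simp
      have "cmod (LINT y|lborel. complex_of_real (exp (- (norm (x - y))\<^sup>2 / (2 * a n))) * h y)
          \<le> (LINT y|lborel. exp (- \<delta>\<^sup>2 * real (Suc n) / 2) * cmod (h y))"
      proof (rule Bochner_Integration.integral_norm_bound_integral)
        have pw: "cmod (complex_of_real (exp (- (norm (x - y))\<^sup>2 / (2 * a n))) * h y) \<le> exp (- \<delta>\<^sup>2 * real (Suc n) / 2) * cmod (h y)" for y
        proof (cases "h y = 0")
          case False
          have "\<delta> \<le> v \<bullet> (x - y)"
            using supp[OF False] by (simp add: \<delta>_def inner_diff_right)
          also have "\<dots> \<le> norm (x - y)"
            using norm_cauchy_schwarz[of v "x - y"] v by simp
          finally have "\<delta>\<^sup>2 \<le> (norm (x - y))\<^sup>2"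
            using \<delta> by (intro power_mono) auto
          then have "\<delta>\<^sup>2 * real (Suc n) / 2 \<le> (norm (x - y))\<^sup>2 * real (Suc n) / 2"
            by (intro divide_right_mono mult_right_mono) auto
          also have "\<dots> = (norm (x - y))\<^sup>2 / (2 * a n)"
            by (simp add: a_def)
          finally have "exp (- (norm (x - y))\<^sup>2 / (2 * a n)) \<le> exp (- \<delta>\<^sup>2 * real (Suc n) / 2)"
            by simp
          then show ?thesis
            by (simp add: norm_mult mult_right_mono del: of_real_exp)
        qed simp
        then show "cmod (complex_of_real (exp (- (norm (x - y))\<^sup>2 / (2 * a n))) * h y) \<le> exp (- \<delta>\<^sup>2 * real (Suc n) / 2) * cmod (h y)" for y .
        show i: "integrable lborel (\<lambda>y. exp (- \<delta>\<^sup>2 * real (Suc n) / 2) * cmod (h y))"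
          by (intro integrable_mult_right integrable_norm hi)
        show "integrable lborel (\<lambda>y. complex_of_real (exp (- (norm (x - y))\<^sup>2 / (2 * a n))) * h y)"
        proof (rule Bochner_Integration.integrable_bound[OF i])
          show "AE y in lborel. norm (complex_of_real (exp (- (norm (x - y))\<^sup>2 / (2 * a n))) * h y) \<le> norm (exp (- \<delta>\<^sup>2 * real (Suc n) / 2) * cmod (h y))"
            using pw by (intro AE_I2) (simp add: abs_mult del: of_nat_Suc of_real_exp)
        qed measurable
      qed
      then have "cmod (LINT y|lborel. complex_of_real (exp (- (norm (x - y))\<^sup>2 / (2 * a n))) * h y) \<le> exp (- \<delta>\<^sup>2 * real (Suc n) / 2) * I"
        by (simp add: I_def del: of_nat_Suc of_real_exp)
      then have "cmod (P n x) \<le> (2 * pi * a n) powr (- N) * (exp (- \<delta>\<^sup>2 * real (Suc n) / 2) * I)"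
        unfolding Pn norm_mult by (intro mult_mono) (auto simp: I_def)
      then show ?thesis
        by (simp add: a_def)
    qed
    have "(\<lambda>n. (2 * pi / real (Suc n)) powr (- N) * (exp (- \<delta>\<^sup>2 * real (Suc n) / 2) * I)) \<longlonglongrightarrow> 0"
    proof -
      have "\<delta>\<^sup>2 > 0" using \<delta> by simp
      then have "(\<lambda>n. ((2 * pi / real (Suc n)) powr (- N) * exp (- \<delta>\<^sup>2 * real (Suc n) / 2))) \<longlonglongrightarrow> 0"
        using N by real_asymp
      then have "(\<lambda>n. ((2 * pi / real (Suc n)) powr (- N) * exp (- \<delta>\<^sup>2 * real (Suc n) / 2)) * I) \<longlonglongrightarrow> 0 * I"
        by (intro tendsto_intros)
      then show ?thesis
        by (simp add: mult.assoc)
    qed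
    then show ?thesis
      by (rule Lim_null_comparison[rotated]) (use bound in auto)
  qed
  note [measurable] = fourier_L2_measurable[OF HL, of 1, simplified]
  define A where "A = (\<integral>\<^sup>+ x. indicator {x. v \<bullet> x > c} x * ennreal ((cmod (fourier_L2 1 H x))\<^sup>2) \<partial>lborel)"
  have A_le: "A \<le> e" if "e > 0" for e
    unfolding A_def
  proof (rule nn_integral_le_of_AE_tendsto)
    let ?u = "\<lambda>n x. indicator {x. v \<bullet> x > c} x * ennreal ((cmod (P n x - fourier_L2 1 H x))\<^sup>2)"
    show "?u n \<in> borel_measurable lborel" for n
      by measurable
    show "AE x in lborel. (\<lambda>n. ?u n x) \<longlonglongrightarrow> indicator {x. v \<bullet> x > c} x * ennreal ((cmod (fourier_L2 1 H x))\<^sup>2)"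
    proof (rule AE_I2)
      fix x
      show "(\<lambda>n. ?u n x) \<longlonglongrightarrow> indicator {x. v \<bullet> x > c} x * ennreal ((cmod (fourier_L2 1 H x))\<^sup>2)"
      proof (cases "v \<bullet> x > c")
        case True
        have "(\<lambda>n. ennreal ((cmod (P n x - fourier_L2 1 H x))\<^sup>2)) \<longlonglongrightarrow> ennreal ((cmod (0 - fourier_L2 1 H x))\<^sup>2)"
          by (intro tendsto_ennrealI tendsto_intros P_lim True)
        with True show ?thesis by simp
      qed simp
    qed
    show "\<forall>\<^sub>F n in sequentially. (\<integral>\<^sup>+ x. ?u n x \<partial>lborel) \<le> e"
      using order_tendstoD(2)[OF lim_g that]
    proof eventually_elim
      case (elim n)
      have "AE x in lborel. fourier_L2 1 (g n) x = P n x"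
        unfolding P_def by (rule fourier_L2_AE_eq[OF gL _ is_fourier_integrable[OF gL gi]]) auto
      moreover have "AE x in lborel. fourier_L2 1 (\<lambda>x. g n x - H x) x = fourier_L2 1 (g n) x - fourier_L2 1 H x"
        by (rule fourier_L2_diff_AE[OF gL HL]) simp
      ultimately have "AE x in lborel. ?u n x \<le> ennreal ((cmod (fourier_L2 1 (\<lambda>x. g n x - H x) x))\<^sup>2)"
        by eventually_elim (auto split: split_indicator)
      then have "(\<integral>\<^sup>+ x. ?u n x \<partial>lborel) \<le> nsq (fourier_L2 1 (\<lambda>x. g n x - H x))"
        unfolding nsq_def by (rule nn_integral_mono_AE)
      also have "\<dots> \<le> nsq (\<lambda>x. g n x - H x)"
        by (rule nsq_fourier_L2_le) (simp_all add: L2_diff gL HL)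
      finally show ?case
        using elim by simp
    qed
  qed
  have "A = 0"
  proof (rule ccontr)
    assume "A \<noteq> 0"
    then obtain e where "0 < e" "e < A"
      using dense[of 0 A] by (auto simp: zero_less_iff_neq_zero)
    with A_le[of e] show False
      by simp
  qed
  then have "AE x in lborel. indicator {x. v \<bullet> x > c} x * ennreal ((cmod (fourier_L2 1 H x))\<^sup>2) = 0"
    unfolding A_def by (subst (asm) nn_integral_0_iff_AE) auto
  then have "AE x in lborel. v \<bullet> x > c \<longrightarrow> fourier_L2 1 H x = 0"
    by eventually_elim (auto split: split_indicator_asm)
  moreover have "fourier_L2 1 (fourier_L2 (-1) h) = fourier_L2 1 H"
    by (rule fourier_L2_cong_AE[OF _ Hm AE_H]) (rule fourier_L2_measurable[OF h], simp)
  ultimately show ?thesis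
    unfolding vanishes_def using L2_fourier_L2[OF h, of "-1"] by simp
qed

lemma theta_tilde_bounded: "\<exists>B. \<forall>y. cmod (theta_tilde y) \<le> B"
proof -
  obtain M where M: "\<And>x. cmod (E_real x) \<le> M"
    using E_real_bounded by blast
  let ?k = "(1 - \<i>) / complex_of_real (2 * sqrt pi)"
  have "cmod (theta_tilde y) \<le> 1 + cmod ?k * (M + cmod E_lim)" for y
  proof -
    have "theta_tilde y = 1 - ?k * (E_real (- y) + E_lim)"
      using one_minus_theta_tilde[of y] by (simp add: algebra_simps)
    then have "cmod (theta_tilde y) \<le> 1 + cmod (?k * (E_real (- y) + E_lim))"
      using norm_triangle_ineq4[of 1 "?k * (E_real (- y) + E_lim)"] by simp
    also have "\<dots> \<le> 1 + cmod ?k * (M + cmod E_lim)"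
      unfolding norm_mult
      by (intro add_left_mono mult_left_mono order_trans[OF norm_triangle_ineq] add_mono M) auto
    finally show ?thesis .
  qed
  then show ?thesis
    by blast
qed

lemma theta_tilde_measurable [measurable]: "theta_tilde \<in> borel_measurable borel"
proof -
  have "theta_tilde = (\<lambda>y. 1 - (1 - \<i>) / complex_of_real (2 * sqrt pi) * (E_real (- y) + E_lim))"
    using one_minus_theta_tilde by (auto simp: fun_eq_iff algebra_simps)
  moreover have "\<dots> \<in> borel_measurable borel"
    by (intro borel_measurable_continuous_onI continuous_intros continuous_on_compose2[OF continuous_E_real]) auto
  ultimately show ?thesis
    by (simp only:)
qed

lemma mult_f_measurable [measurable]: "mult_f fr \<in> borel_measurable borel"
  unfolding mult_f_def by measurable

lemma propD_halfspace_le: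
  fixes h :: "real^'n \<Rightarrow> complex"
  assumes fr: "fr > 0" and D: "D > 0" and h: "L2 h" "integrable lborel h"
    and s: "\<bar>s\<bar> = 1" and supp: "\<And>x. h x \<noteq> 0 \<Longrightarrow> s * x $ j \<le> c"
  shows "(\<integral>\<^sup>+ x. indicator {x. s * x $ j > c + D} x * ennreal ((cmod (propD fr h x))\<^sup>2) \<partial>lborel)
    \<le> (\<integral>\<^sup>+ \<xi>. ennreal ((cmod (theta_tilde (s * \<xi> $ j / sqrt fr - sqrt (D\<^sup>2 * fr))))\<^sup>2 * (cmod (FT h \<xi>))\<^sup>2) \<partial>lborel)"
proof -
  define v :: "real^'n" where "v = axis j s"
  define T where "T = (\<lambda>\<xi>::real^'n. theta_tilde (s * \<xi> $ j / sqrt fr - sqrt (D\<^sup>2 * fr)))"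
  have vx: "v \<bullet> x = s * x $ j" for x
    by (simp add: v_def inner_axis' mult.commute)
  have FL: "L2 (FT h)"
    unfolding FT_def using h(1) by (rule L2_fourier_L2) simp
  have [measurable]: "T \<in> borel_measurable borel"
    unfolding T_def by measurable
  obtain B where B: "\<And>y. cmod (theta_tilde y) \<le> B"
    using theta_tilde_bounded by blast
  have m1: "cmod (mult_f fr \<xi>) = 1" for \<xi> :: "real^'n"
    by (simp add: mult_f_def)
  have L1: "L2 (\<lambda>\<xi>. mult_f fr \<xi> * FT h \<xi>)"
    by (rule L2_cmult_bound[OF FL, where B = 1]) (auto simp: m1)
  have L2': "L2 (\<lambda>\<xi>. (mult_f fr \<xi> * T \<xi>) * FT h \<xi>)"
    by (rule L2_cmult_bound[OF FL, where B = B]) (auto simp: m1 norm_mult T_def B)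
  have "norm v = 1"
    using s by (simp add: v_def norm_eq_sqrt_inner inner_axis_axis)
  then have "vanishes v c (FT h)"
    unfolding FT_def by (intro vanishes_fourier_L2 h) (use supp vx in auto)
  moreover have "shift_multiplier v D (\<lambda>\<xi>. mult_f fr \<xi> * (1 - T \<xi>))"
    unfolding T_def by (rule shift_multiplier_mult_f_theta_tilde[OF fr s D v_def])
  ultimately have "vanishes v (c + D) (\<lambda>\<xi>. mult_f fr \<xi> * (1 - T \<xi>) * FT h \<xi>)"
    by (auto simp: shift_multiplier_def)
  moreover have "mult_f fr \<xi> * (1 - T \<xi>) * FT h \<xi> = mult_f fr \<xi> * FT h \<xi> - (mult_f fr \<xi> * T \<xi>) * FT h \<xi>" for \<xi>
    by (simp add: algebra_simps)
  ultimately have "AE x in lborel. v \<bullet> x > c + D \<longrightarrow>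
      fourier_L2 1 (\<lambda>\<xi>. mult_f fr \<xi> * FT h \<xi> - (mult_f fr \<xi> * T \<xi>) * FT h \<xi>) x = 0"
    by (simp add: vanishes_def)
  with fourier_L2_diff_AE[OF L1 L2', of 1, OF abs_one]
  have "AE x in lborel. indicator {x. s * x $ j > c + D} x * ennreal ((cmod (propD fr h x))\<^sup>2)
      \<le> ennreal ((cmod (fourier_L2 1 (\<lambda>\<xi>. (mult_f fr \<xi> * T \<xi>) * FT h \<xi>) x))\<^sup>2)"
    by eventually_elim (auto simp: propD_def IFT_def vx split: split_indicator)
  then have "(\<integral>\<^sup>+ x. indicator {x. s * x $ j > c + D} x * ennreal ((cmod (propD fr h x))\<^sup>2) \<partial>lborel)
      \<le> nsq (fourier_L2 1 (\<lambda>\<xi>. (mult_f fr \<xi> * T \<xi>) * FT h \<xi>))"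
    unfolding nsq_def by (rule nn_integral_mono_AE)
  also have "\<dots> \<le> nsq (\<lambda>\<xi>. (mult_f fr \<xi> * T \<xi>) * FT h \<xi>)"
    by (rule nsq_fourier_L2_le[OF L2']) simp
  also have "\<dots> = (\<integral>\<^sup>+ \<xi>. ennreal ((cmod (T \<xi>))\<^sup>2 * (cmod (FT h \<xi>))\<^sup>2) \<partial>lborel)"
    by (simp add: nsq_def norm_mult m1 power_mult_distrib)
  finally show ?thesis
    by (simp only: T_def)
qed

theorem theorem4p4:
  fixes fr \<Delta> :: real and h :: "real^'n \<Rightarrow> complex"
  assumes "fr > 0" and "0 < \<Delta>" and "\<Delta> < 1 / 2"
    and "h \<in> L2_on (cube (1 / 2 - \<Delta>))"
  shows "(\<integral>\<^sup>+ x. ennreal ((cmod (indicator (- cube (1 / 2)) x * propD fr h x))\<^sup>2) \<partial>lborel)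
       \<le> (\<integral>\<^sup>+ \<xi>. ennreal ((cmod (complex_of_real (p_leak fr (\<Delta>\<^sup>2 * fr) \<xi>) * FT h \<xi>))\<^sup>2) \<partial>lborel)"
proof -
  have h: "L2 h"
    using assms(4) by (simp add: L2_on_def L2_def nsq_def)
  have supp: "\<bar>x $ j\<bar> \<le> 1 / 2 - \<Delta>" if "h x \<noteq> 0" for x :: "real^'n" and j
    using assms(4) that by (auto simp: L2_on_def cube_def)
  have hi: "integrable lborel h"
  proof (rule L2_bounded_support_integrable[OF h])
    fix x :: "real^'n" assume x: "x \<notin> ball 0 (real CARD('n))"
    show "h x = 0"
    proof (rule ccontr)
      assume "h x \<noteq> 0"
      have "norm x \<le> (\<Sum>j\<in>UNIV. \<bar>x $ j\<bar>)"
        by (rule norm_le_l1_cart)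
      also have "\<dots> < (\<Sum>j\<in>(UNIV::'n set). 1)"
      proof (rule sum_strict_mono)
        show "\<bar>x $ j\<bar> < 1" for j
          using supp[OF \<open>h x \<noteq> 0\<close>, of j] assms(2) by linarith
      qed auto
      finally show False
        using x by simp
    qed
  qed
  have FL: "L2 (FT h)"
    unfolding FT_def using h by (rule L2_fourier_L2) simp
  have "L2 (propD fr h)"
    unfolding propD_def IFT_def
    by (intro L2_fourier_L2 L2_cmult_bound[OF FL, where B = 1]) (auto simp: mult_f_def)
  note [measurable] = L2_measurable[OF FL] L2_measurable[OF this]
  define W where "W = (\<lambda>s j (x::real^'n). indicator {x. s * x $ j > 1 / 2} x * ennreal ((cmod (propD fr h x))\<^sup>2))"
  define V where "V = (\<lambda>s j (\<xi>::real^'n). ennreal ((cmod (theta_tilde (s * \<xi> $ j / sqrt fr - sqrt (\<Delta>\<^sup>2 * fr))))\<^sup>2 * (cmod (FT h \<xi>))\<^sup>2))"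
  have [measurable]: "W s j \<in> borel_measurable borel" "V s j \<in> borel_measurable borel" for s and j :: 'n
    unfolding W_def V_def by measurable
  have WV: "(\<integral>\<^sup>+ x. W s j x \<partial>lborel) \<le> (\<integral>\<^sup>+ \<xi>. V s j \<xi> \<partial>lborel)" if s: "\<bar>s\<bar> = 1" for s j
  proof -
    have "s * x $ j \<le> 1 / 2 - \<Delta>" if "h x \<noteq> 0" for x :: "real^'n"
      using supp[OF that, of j] s by (auto simp: abs_if split: if_splits)
    from propD_halfspace_le[OF assms(1,2) h hi s this] show ?thesis
      by (simp add: W_def V_def)
  qed
  have "(\<integral>\<^sup>+ x. ennreal ((cmod (indicator (- cube (1 / 2)) x * propD fr h x))\<^sup>2) \<partial>lborel)
      \<le> (\<integral>\<^sup>+ x. (\<Sum>j\<in>UNIV. W 1 j x + W (-1) j x) \<partial>lborel)"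
  proof (rule nn_integral_mono)
    fix x :: "real^'n"
    show "ennreal ((cmod (indicator (- cube (1 / 2)) x * propD fr h x))\<^sup>2) \<le> (\<Sum>j\<in>UNIV. W 1 j x + W (-1) j x)"
    proof (cases "x \<in> cube (1 / 2)")
      case False
      then obtain j where j: "\<bar>x $ j\<bar> > 1 / 2"
        by (auto simp: cube_def not_le)
      then have "ennreal ((cmod (propD fr h x))\<^sup>2) \<le> W 1 j x + W (-1) j x"
        by (auto simp: W_def abs_if split: if_splits)
      also have "\<dots> \<le> (\<Sum>j\<in>UNIV. W 1 j x + W (-1) j x)"
        by (rule member_le_sum) auto
      finally show ?thesis
        using False by simp
    qed simp
  qed
  also have "\<dots> = (\<Sum>j\<in>UNIV. (\<integral>\<^sup>+ x. W 1 j x \<partial>lborel) + (\<integral>\<^sup>+ x. W (-1) j x \<partial>lborel))"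
    by (simp add: nn_integral_sum nn_integral_add)
  also have "\<dots> \<le> (\<Sum>j\<in>UNIV. (\<integral>\<^sup>+ \<xi>. V 1 j \<xi> \<partial>lborel) + (\<integral>\<^sup>+ \<xi>. V (-1) j \<xi> \<partial>lborel))"
    by (intro sum_mono add_mono WV) auto
  also have "\<dots> = (\<integral>\<^sup>+ \<xi>. (\<Sum>j\<in>UNIV. V 1 j \<xi> + V (-1) j \<xi>) \<partial>lborel)"
    by (simp add: nn_integral_sum nn_integral_add)
  also have "\<dots> = (\<integral>\<^sup>+ \<xi>. ennreal ((cmod (complex_of_real (p_leak fr (\<Delta>\<^sup>2 * fr) \<xi>) * FT h \<xi>))\<^sup>2) \<partial>lborel)"
  proof (rule nn_integral_cong)
    fix \<xi> :: "real^'n"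
    let ?c = "(cmod (FT h \<xi>))\<^sup>2"
    have "(cmod (complex_of_real (p_leak fr (\<Delta>\<^sup>2 * fr) \<xi>) * FT h \<xi>))\<^sup>2 = (p_leak fr (\<Delta>\<^sup>2 * fr) \<xi>)\<^sup>2 * ?c"
      by (simp add: norm_mult power_mult_distrib)
    also have "(p_leak fr (\<Delta>\<^sup>2 * fr) \<xi>)\<^sup>2 = (\<Sum>j\<in>UNIV. (e_leak (\<Delta>\<^sup>2 * fr) (\<xi> $ j / sqrt fr))\<^sup>2)"
      by (simp add: p_leak_def sum_nonneg)
    also have "\<dots> * ?c = (\<Sum>j\<in>UNIV. (cmod (theta_tilde (1 * \<xi> $ j / sqrt fr - sqrt (\<Delta>\<^sup>2 * fr))))\<^sup>2 * ?c
        + (cmod (theta_tilde (-1 * \<xi> $ j / sqrt fr - sqrt (\<Delta>\<^sup>2 * fr))))\<^sup>2 * ?c)"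
      by (simp add: e_leak_def sum_distrib_right distrib_right)
    finally show "(\<Sum>j\<in>UNIV. V 1 j \<xi> + V (-1) j \<xi>)
        = ennreal ((cmod (complex_of_real (p_leak fr (\<Delta>\<^sup>2 * fr) \<xi>) * FT h \<xi>))\<^sup>2)"
      by (simp add: V_def sum_nonneg flip: ennreal_plus sum_ennreal)
  qed
  finally show ?thesis .
qed

end
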